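(* Let $U:\mathbb{R}^d\to\mathbb{R}$ be in $\mathcal{C}^4(\mathbb{R}^d)$ with $\int e^{-U(x)}dx<\infty$, having a global minimum at $0$ with $U(0)=0$, and such that $L:=\sup\|D^2U\|<\infty$, $L_H:=\sup\|D^3U\|<\infty$, $L_I:=\sup\|D^4U\|<\infty$. Let $T>0$ and $h>0$ satisfy $T/h\in\mathbb{N}$ and $L(T^2+Th)\le 1/6$. Let $\tilde\pi$ be the transition kernel of unadjusted Hamiltonian Monte Carlo with duration $T$ and step size $h$. Suppose that there is an invariant probability measure $\tilde\mu$ of $\tilde\pi$ such that (A5) there exist constants $M_1,c\in(0,\infty)$ such that for any $m\in\mathbb{N}$ and any probability measure $\nu$ on $\mathbb{R}^d$, $W^1(\nu\tilde\pi^m,\tilde\mu)\le M_1e^{-cm}W^1(\nu,\tilde\mu)$; (A6) there exists a constant $M_2\in(0,\infty)$ such that $W^1(\mu,\tilde\mu)\le M_2h^2$. For $\varepsilon>0$ and a probability measure $\nu$ on $\mathbb{R}^d$ let $t_{\mathrm{mix}}(\varepsilon,\nu):=\inf\{m\ge0:\mathrm{TV}(\tilde\mu,\nu\tilde\pi^m)\le\varepsilon\}$. Then for any $\varepsilon>0$ and any probability measure $\nu$ on $\mathbb{R}^d$, $$t_{\mathrm{mix}}(\varepsilon,\nu)\ \le\ 2+\frac1c\,\log\left(\frac{3\left(T^{-2}+27\,d\,L_H^2\,T^4\right)^{1/2}M_1\,W^1(\tilde\mu,\nu)}{2\varepsilon}\right).$$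
   Context: $|\cdot|$ is the Euclidean norm and $\|\cdot\|$ the operator norm of a multilinear form (supremum over unit vectors in each argument). The target measure is $\mu(dx)=Z^{-1}e^{-U(x)}dx$, $Z=\int e^{-U(x)}dx$. Velocity Verlet: for $h>0$ let $\lfloor t\rfloor_h=\max\{s\in h\mathbb{Z}:s\le t\}$ and $\lceil t\rceil_h=\min\{s\in h\mathbb{Z}:s\ge t\}$. For $(x,v)\in\mathbb{R}^{2d}$, $(\tilde q_t(x,v),\tilde v_t(x,v))_{t\ge0}$ is the continuous, piecewise differentiable solution of $$\tfrac{d}{dt}\tilde q_t=\tilde v_{\lfloor t\rfloor_h}-(t-\lfloor t\rfloor_h)\nabla U(\tilde q_{\lfloor t\rfloor_h}),\qquad \tfrac{d}{dt}\tilde v_t=-\tfrac12\left(\nabla U(\tilde q_{\lfloor t\rfloor_h})+\nabla U(\tilde q_{\lceil t\rceil_h})\right)$$ with $(\tilde q_0,\tilde v_0)=(x,v)$. Equivalently, on the grid $t_k=kh$: $\tilde q_{t_{k+1}}=\tilde q_{t_k}+h\tilde v_{t_k}-\frac{h^2}{2}\nabla U(\tilde q_{t_k})$ and $\tilde v_{t_{k+1}}=\tilde v_{t_k}-\frac h2[\nabla U(\tilde q_{t_k})+\nabla U(\tilde q_{t_{k+1}})]$. The unadjusted HMC (uHMC) kernel with duration $T$ and step size $h$ is $\tilde\pi(x,A)=P[\tilde q_T(x,\xi)\in A]$ with $\xi\sim\mathcal N(0,I_d)$. For a probability measure $\nu$, $\nu\tilde\pi(A)=\int\nu(dx)\tilde\pi(x,A)$,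 and $\tilde\pi^m$ is the $m$-fold composition. $\mathrm{TV}(\nu,\eta)=\sup_A|\nu(A)-\eta(A)|$ over Borel sets $A$. $W^1(\nu,\eta)=\inf E[|X-Y|]$ over all couplings $(X,Y)$ of $\nu,\eta$ (possibly $+\infty$).
   Formalization: The bound proved is t_mix ≤ max{1, right-hand side}: as stated it fails when the right-hand side is below 1, e.g. for ν equal or very close to μ̃ in W¹, where it is −∞ or negative while t_mix ≥ 0. *)

theory Defs
  imports "HOL-Probability.Probability"
begin

definition fderiv :: "('a::real_normed_vector \<Rightarrow> 'b::real_normed_vector) \<Rightarrow> 'a \<Rightarrow> 'a \<Rightarrow>\<^sub>L 'b" where
  "fderiv f x = Blinfun (frechet_derivative f (at x))"

(* The k-th derivative is a nested bounded linear map.  By the lemma norm_blinfun_sphere below,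
   applied once per argument, its norm is the supremum of its absolute values over unit vectors
   in each argument, i.e. the operator norm of the corresponding k-linear form. *)

abbreviation D2 :: "('a::real_normed_vector \<Rightarrow> real) \<Rightarrow> 'a \<Rightarrow> 'a \<Rightarrow>\<^sub>L 'a \<Rightarrow>\<^sub>L real" where
  "D2 U \<equiv> fderiv (fderiv U)"

abbreviation D3 :: "('a::real_normed_vector \<Rightarrow> real) \<Rightarrow> 'a \<Rightarrow> 'a \<Rightarrow>\<^sub>L 'a \<Rightarrow>\<^sub>L 'a \<Rightarrow>\<^sub>L real" where
  "D3 U \<equiv> fderiv (D2 U)"

abbreviation D4 :: "('a::real_normed_vector \<Rightarrow> real) \<Rightarrow> 'a \<Rightarrow> 'a \<Rightarrow>\<^sub>L 'a \<Rightarrow>\<^sub>L 'a \<Rightarrow>\<^sub>L 'a \<Rightarrow>\<^sub>L real" where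
  "D4 U \<equiv> fderiv (D3 U)"

definition C4 :: "('a::real_normed_vector \<Rightarrow> real) \<Rightarrow> bool" where
  "C4 U \<longleftrightarrow> U differentiable_on UNIV \<and> fderiv U differentiable_on UNIV \<and>
     D2 U differentiable_on UNIV \<and> D3 U differentiable_on UNIV \<and> continuous_on UNIV (D4 U)"

lemma norm_blinfun_sphere:
  fixes f :: "'a::euclidean_space \<Rightarrow>\<^sub>L 'b::real_normed_vector"
  shows "norm f = (SUP u\<in>sphere 0 1. norm (blinfun_apply f u))"
proof (rule antisym)
  have ne: "sphere (0::'a) 1 \<noteq> {}" by simp
  have bdd: "bdd_above ((\<lambda>u. norm (blinfun_apply f u)) ` sphere 0 1)"
    by (rule bdd_aboveI2[where M = "norm f"]) (metis mem_sphere_0 mult.right_neutral norm_blinfun)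
  show "(SUP u\<in>sphere 0 1. norm (blinfun_apply f u)) \<le> norm f"
    by (rule cSUP_least[OF ne]) (metis mem_sphere_0 mult.right_neutral norm_blinfun)
  show "norm f \<le> (SUP u\<in>sphere 0 1. norm (blinfun_apply f u))" (is "_ \<le> ?S")
  proof (rule norm_blinfun_bound)
    obtain u :: 'a where u: "u \<in> sphere 0 1" using ne by blast
    show "0 \<le> ?S" by (rule cSUP_upper2[OF bdd u]) simp
    fix x :: 'a
    show "norm (blinfun_apply f x) \<le> ?S * norm x"
    proof (cases "x = 0")
      case False
      then have "norm (blinfun_apply f (x /\<^sub>R norm x)) \<le> ?S"
        by (intro cSUP_upper[OF _ bdd]) simp
      with False show ?thesis by (simp add: blinfun.scaleR_right field_simps)
    qed (simp add: blinfun.zero_right)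
  qed
qed

definition grad :: "('a::real_inner \<Rightarrow> real) \<Rightarrow> 'a \<Rightarrow> 'a" where
  "grad U x = (THE g. GDERIV U x :> g)"

definition gibbs :: "('a::euclidean_space \<Rightarrow> real) \<Rightarrow> 'a measure" where
  "gibbs U = density lborel (\<lambda>x. ennreal (exp (- U x) / (\<integral>y. exp (- U y) \<partial>lborel)))"

definition std_gauss :: "(real ^ 'd) measure" where
  "std_gauss = density lborel (\<lambda>v. ennreal (\<Prod>i\<in>UNIV. std_normal_density (v $ i)))"

definition verlet_step :: "('a::real_inner \<Rightarrow> real) \<Rightarrow> real \<Rightarrow> 'a \<times> 'a \<Rightarrow> 'a \<times> 'a" where
  "verlet_step U h = (\<lambda>(q, v).
     let q' = q + h *\<^sub>R v - (h\<^sup>2 / 2) *\<^sub>R grad U q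
     in (q', v - (h / 2) *\<^sub>R (grad U q + grad U q')))"

(* Only meaningful when T / h is a natural number, so that T is a grid point. *)
definition verlet_position :: "('a::real_inner \<Rightarrow> real) \<Rightarrow> real \<Rightarrow> real \<Rightarrow> 'a \<Rightarrow> 'a \<Rightarrow> 'a" where
  "verlet_position U T h x v = fst ((verlet_step U h ^^ nat \<lfloor>T / h\<rfloor>) (x, v))"

definition uhmc :: "(real ^ 'd \<Rightarrow> real) \<Rightarrow> real \<Rightarrow> real \<Rightarrow> real ^ 'd \<Rightarrow> (real ^ 'd) measure" where
  "uhmc U T h x = distr std_gauss borel (verlet_position U T h x)"

primrec kernel_pow :: "('a::topological_space \<Rightarrow> 'a measure) \<Rightarrow> nat \<Rightarrow> 'a \<Rightarrow> 'a measure" where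
  "kernel_pow K 0 = return borel"
| "kernel_pow K (Suc m) = (\<lambda>x. K x \<bind> kernel_pow K m)"

definition TV :: "'a::topological_space measure \<Rightarrow> 'a measure \<Rightarrow> real" where
  "TV \<nu> \<eta> = (SUP A\<in>sets borel. \<bar>measure \<nu> A - measure \<eta> A\<bar>)"

definition couplings :: "'a::topological_space measure \<Rightarrow> 'a measure \<Rightarrow> ('a \<times> 'a) measure set" where
  "couplings \<nu> \<eta> = {\<gamma> \<in> space (prob_algebra (borel \<Otimes>\<^sub>M borel)).
     distr \<gamma> borel fst = \<nu> \<and> distr \<gamma> borel snd = \<eta>}"

definition W1 :: "'a::real_normed_vector measure \<Rightarrow> 'a measure \<Rightarrow> ennreal" where
  "W1 \<nu> \<eta> = (INF \<gamma>\<in>couplings \<nu> \<eta>. \<integral>\<^sup>+ (x, y). ennreal (norm (x - y)) \<partial>\<gamma>)"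

definition t_mix :: "('a::topological_space \<Rightarrow> 'a measure) \<Rightarrow> 'a measure \<Rightarrow> real \<Rightarrow> 'a measure \<Rightarrow> ereal" where
  "t_mix K \<mu>' \<epsilon> \<nu> = (INF m\<in>{m. TV \<mu>' (\<nu> \<bind> kernel_pow K m) \<le> \<epsilon>}. ereal (real m))"

definition ln_ennreal :: "ennreal \<Rightarrow> ereal" where
  "ln_ennreal x = (if x = 0 then - \<infinity> else if x = \<infinity> then \<infinity> else ereal (ln (enn2real x)))"

end

theory Submission
  imports Defs
begin

text \<open>
  Everything rests on the one-step estimate
  \<open>TV (uhmc U T h x) (uhmc U T h y) \<le> 3/2 sqrt (1/T\<^sup>2 + 27 d L\<^sub>H\<^sup>2 T\<^sup>4) |x - y|\<close>:
  integrated against couplings it turns the \<open>W1\<close> contraction (A5) after \<open>m\<close> steps into a total variation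
  bound after \<open>m + 1\<close> steps.

  For the estimate, let \<open>q x v\<close> be the Verlet position at time \<open>T\<close>. Under \<open>L T\<^sup>2 \<le> 1/6\<close> the map \<open>q x\<close> is a
  perturbation of \<open>v \<mapsto> x + T v\<close>, so there is a bijection \<open>\<Phi>\<close> with \<open>q y (\<Phi> v) = q x v\<close>,
  \<open>|\<Phi> v - v| \<le> 6/5 |x - y| / T\<close> and \<open>\<parallel>D\<Phi> - I\<parallel>, \<parallel>D\<Phi>\<^sup>-\<^sup>1 - I\<parallel> \<le> 2 L\<^sub>H T\<^sup>2 |x - y|\<close>. It remains to compare the
  standard Gaussian density \<open>p\<close> with \<open>p (\<Phi> v) |det D\<Phi> v|\<close>. Their Hellinger affinity is bounded below
  through \<open>exp l \<ge> 1 + l\<close> applied to half the log-ratio \<open>l\<close>. In the expectation of \<open>l\<close> the first order term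
  \<open>v \<bullet> (\<Phi> v - v)\<close> cancels against the trace of \<open>D\<Phi> - I\<close> (Gaussian integration by parts); the second order
  remainder of \<open>ln |det D\<Phi>|\<close> is controlled by Hadamard's inequality for \<open>D\<Phi>\<^sup>-\<^sup>1\<close>. This cancellation is what
  gives \<open>sqrt d\<close> instead of \<open>d\<close>.
\<close>

section \<open>Determinants near the identity\<close>

text \<open>Gram-Schmidt, one row at a time. Subtracting from row \<open>k\<close> its projection
  onto the rows already treated is a row operation, so it keeps the determinant, and by Pythagoras
  it cannot lengthen the row. Nothing is normalized, since that would change the
  determinant.\<close>

lemma orthogonalize_rows:
  fixes A :: "real^'n^'n"
  assumes "finite K"
  shows "\<exists>A'::real^'n^'n. det A' = det A \<and> (\<forall>i. norm (row i A') \<le> norm (row i A)) \<and>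
    (\<forall>i\<in>K. \<forall>j\<in>K. i \<noteq> j \<longrightarrow> row i A' \<bullet> row j A' = 0)"
  using assms
proof (induction K)
  case empty
  show ?case by (intro exI[of _ A]) auto
next
  case (insert k K)
  then obtain A' :: "real^'n^'n" where A': "det A' = det A" "\<And>i. norm (row i A') \<le> norm (row i A)"
    "\<And>i j. i \<in> K \<Longrightarrow> j \<in> K \<Longrightarrow> i \<noteq> j \<Longrightarrow> row i A' \<bullet> row j A' = 0"
    by blast
  obtain y z where yz: "y \<in> span ((\<lambda>j. row j A') ` K)" 
    "\<And>w. w \<in> span ((\<lambda>j. row j A') ` K) \<Longrightarrow> orthogonal z w" "row k A' = y + z"
    using orthogonal_subspace_decomp_exists by blast
  define A'' :: "real^'n^'n" where "A'' = (\<chi> j. if j = k then row k A' + (- y) else row j A')"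
  have "- y \<in> vec.span {row j A' |j. j \<noteq> k}"
  proof -
    have "y \<in> span {row j A' |j. j \<noteq> k}"
      using yz(1) by (rule subsetD[OF span_mono, rotated]) (use insert.hyps in auto)
    then show ?thesis by (simp add: span_neg span_vec_eq)
  qed
  then have det: "det A'' = det A'" unfolding A''_def by (rule det_row_span)
  have row_k: "row k A'' = z" and row_other: "\<And>j. j \<noteq> k \<Longrightarrow> row j A'' = row j A'"
    using yz(3) by (auto simp: A''_def row_def vec_eq_iff)
  have "(norm (y + z))\<^sup>2 = (norm y)\<^sup>2 + (norm z)\<^sup>2"
    using yz by (intro norm_add_Pythagorean) (auto simp: orthogonal_commute)
  then have "norm z \<le> norm (row k A')"
    using yz(3) by (metis power2_le_imp_le le_add_same_cancel2 norm_ge_zero zero_le_power2)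
  with A' row_k row_other have norms: "norm (row i A'') \<le> norm (row i A)" for i
    by (cases "i = k") (auto intro: order_trans)
  have orth: "z \<bullet> row j A' = 0" if "j \<in> K" for j
    using yz(2)[of "row j A'"] that by (auto simp: orthogonal_def intro: span_base)
  show ?case
  proof (intro exI[of _ A''] conjI ballI impI allI norms)
    show "det A'' = det A" using det A' by simp
    fix i j assume "i \<in> insert k K" "j \<in> insert k K" "i \<noteq> j"
    then show "row i A'' \<bullet> row j A'' = 0"
      using orth A'(3) row_k row_other insert.hyps by (cases "i = k"; cases "j = k") (auto simp: inner_commute)
  qed
qed

text \<open>Once all rows are orthogonal, \<open>A' ** transpose A'\<close> is diagonal with the
  squared row norms as entries, and the orthogonalization has not lengthened any row.\<close>

theorem Hadamard_inequality:
  fixes A :: "real^'n^'n"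
  shows "\<bar>det A\<bar> \<le> (\<Prod>i\<in>UNIV. norm (row i A))"
proof -
  obtain A' :: "real^'n^'n" where A': "det A' = det A" "\<And>i. norm (row i A') \<le> norm (row i A)"
    "\<And>i j. i \<noteq> j \<Longrightarrow> row i A' \<bullet> row j A' = 0"
    using orthogonalize_rows[of UNIV A] by auto
  have entry: "(A' ** transpose A') $ i $ j = row i A' \<bullet> row j A'" for i j
    by (simp add: matrix_matrix_mult_def transpose_def row_def inner_vec_def)
  have "(det A')\<^sup>2 = det (A' ** transpose A')"
    by (simp add: det_mul power2_eq_square)
  also have "\<dots> = (\<Prod>i\<in>UNIV. (A' ** transpose A') $ i $ i)"
    by (rule det_diagonal) (simp add: entry A')
  also have "\<dots> = (\<Prod>i\<in>UNIV. norm (row i A'))\<^sup>2"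
    by (simp add: entry dot_square_norm prod_power_distrib)
  finally have "\<bar>det A'\<bar> = (\<Prod>i\<in>UNIV. norm (row i A'))"
    by (metis abs_of_nonneg norm_ge_zero power2_eq_iff_nonneg prod_nonneg abs_ge_zero power2_abs)
  also have "\<dots> \<le> (\<Prod>i\<in>UNIV. norm (row i A))"
    by (intro prod_mono) (simp add: A')
  finally show ?thesis by (simp add: A')
qed

text \<open>Hadamard's inequality is applied to the columns \<open>F (axis i 1)\<close>. The squared
  length of such a column is 1 plus twice the diagonal entry of \<open>F - I\<close> plus a term of
  size \<open>\<kappa>\<^sup>2\<close>, so beyond the trace the exponent only carries an error of
  second order in \<kappa>.\<close>

lemma abs_det_le_exp_trace:
  fixes F :: "real^'n \<Rightarrow> real^'n" and \<kappa> :: real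
  assumes bound: "\<And>u. norm (F u - u) \<le> \<kappa> * norm u"
  shows "\<bar>det (matrix F)\<bar> \<le> exp ((\<Sum>i\<in>UNIV. (F (axis i 1) - axis i 1) $ i) + CARD('n) * \<kappa>\<^sup>2 / 2)"
proof -
  have "norm (row i (transpose (matrix F))) \<le> exp ((F (axis i 1) - axis i 1) $ i + \<kappa>\<^sup>2 / 2)" for i
  proof -
    let ?e = "axis i (1::real)"
    have row: "row i (transpose (matrix F)) = F ?e"
      by (simp add: matrix_def row_def transpose_def vec_eq_iff)
    have "norm (F ?e - ?e) \<le> \<kappa>" using bound[of ?e] by simp
    then have sq: "(norm (F ?e - ?e))\<^sup>2 \<le> \<kappa>\<^sup>2" by (intro power_mono) auto
    have "(norm (F ?e))\<^sup>2 = (norm (?e + (F ?e - ?e)))\<^sup>2" by simp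
    also have "\<dots> = 1 + 2 * ((F ?e - ?e) $ i) + (norm (F ?e - ?e))\<^sup>2"
      by (simp only: power2_norm_eq_inner inner_add_left inner_add_right)
         (simp add: inner_axis' inner_axis algebra_simps)
    also have "\<dots> \<le> 1 + 2 * ((F ?e - ?e) $ i + \<kappa>\<^sup>2 / 2)" using sq by simp
    also have "\<dots> \<le> exp (2 * ((F ?e - ?e) $ i + \<kappa>\<^sup>2 / 2))" by (rule exp_ge_add_one_self)
    also have "\<dots> = (exp ((F ?e - ?e) $ i + \<kappa>\<^sup>2 / 2))\<^sup>2" by (simp only: exp_double)
    finally show ?thesis unfolding row by (rule power2_le_imp_le) simp
  qed
  then have "(\<Prod>i\<in>UNIV. norm (row i (transpose (matrix F)))) \<le>
      (\<Prod>i\<in>UNIV. exp ((F (axis i 1) - axis i 1) $ i + \<kappa>\<^sup>2 / 2))"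
    by (intro prod_mono) auto
  also have "\<dots> = exp ((\<Sum>i\<in>UNIV. (F (axis i 1) - axis i 1) $ i) + CARD('n) * \<kappa>\<^sup>2 / 2)"
    by (simp add: exp_sum[symmetric] sum.distrib)
  finally show ?thesis
    using Hadamard_inequality[of "transpose (matrix F)"] by (simp add: det_transpose)
qed

text \<open>The lower bound comes from the upper bound for the inverse \<open>G\<close>. The trace
  of \<open>G - I\<close> exceeds minus the trace of \<open>F - I\<close> by at most
  \<open>CARD('n) * \<kappa>\<^sup>2\<close>; Hadamard adds half of this amount, which explains the
  factor 3/2.\<close>

lemma abs_det_ge_exp_trace:
  fixes F G :: "real^'n \<Rightarrow> real^'n" and \<kappa> :: real
  assumes F: "linear F" and G: "linear G" and FG: "\<And>u. F (G u) = u"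
    and boundF: "\<And>u. norm (F u - u) \<le> \<kappa> * norm u" and boundG: "\<And>u. norm (G u - u) \<le> \<kappa> * norm u"
  shows "exp ((\<Sum>i\<in>UNIV. (F (axis i 1) - axis i 1) $ i) - 3 * CARD('n) * \<kappa>\<^sup>2 / 2) \<le> \<bar>det (matrix F)\<bar>"
proof -
  let ?trF = "\<Sum>i\<in>UNIV. (F (axis i 1) - axis i 1) $ i"
  let ?trG = "\<Sum>i\<in>UNIV. (G (axis i 1) - axis i 1) $ i"
  have k0: "\<kappa> \<ge> 0" using boundF[of "axis undefined 1"] by (simp add: order_trans[OF norm_ge_zero])
  have "matrix F ** matrix G = mat 1"
    using FG by (simp add: matrix_compose[OF G F, symmetric] o_def matrix_id_mat_1[symmetric] id_def)
  then have "det (matrix F) * det (matrix G) = 1" by (metis det_I det_mul)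
  then have prod: "\<bar>det (matrix F)\<bar> * \<bar>det (matrix G)\<bar> = 1" by (metis abs_1 abs_mult)
  have "(F (axis i 1) - axis i 1) $ i + (G (axis i 1) - axis i 1) $ i \<le> \<kappa>\<^sup>2" for i :: 'n
  proof -
    let ?e = "axis i (1::real)"
    let ?u = "G ?e - ?e"
    \<comment> \<open>Applying \<open>F\<close> to \<open>G ?e = ?e + ?u\<close> shows that the two
      first order terms add up to the second order term \<open>- (F - I) (G - I) ?e\<close>.\<close>
    have "F ?u - ?u = - ((F ?e - ?e) + ?u)"
      using FG[of ?e] by (simp add: linear_diff[OF F])
    then have "(F ?e - ?e) $ i + ?u $ i = - ((F ?u - ?u) $ i)" by simp
    also have "\<dots> \<le> norm (F ?u - ?u)" using component_le_norm_cart[of "F ?u - ?u" i] by simp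
    also have "\<dots> \<le> \<kappa> * norm ?u" by (rule boundF)
    also have "\<dots> \<le> \<kappa> * \<kappa>" using boundG[of ?e] k0 by (intro mult_left_mono) auto
    finally show ?thesis by (simp add: power2_eq_square)
  qed
  then have "(\<Sum>i\<in>UNIV. (F (axis i 1) - axis i 1) $ i + (G (axis i 1) - axis i 1) $ i) \<le> (\<Sum>i\<in>(UNIV::'n set). \<kappa>\<^sup>2)"
    by (intro sum_mono)
  then have tr: "?trF + ?trG \<le> CARD('n) * \<kappa>\<^sup>2" unfolding sum.distrib by simp
  have "exp (?trF - 3 * CARD('n) * \<kappa>\<^sup>2 / 2) * \<bar>det (matrix G)\<bar> \<le>
        exp (?trF - 3 * CARD('n) * \<kappa>\<^sup>2 / 2) * exp (?trG + CARD('n) * \<kappa>\<^sup>2 / 2)"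
    by (intro mult_left_mono abs_det_le_exp_trace boundG) auto
  also have "\<dots> = exp (?trF + ?trG - CARD('n) * \<kappa>\<^sup>2)"
    by (simp add: exp_add[symmetric] field_simps)
  also have "\<dots> \<le> 1" using tr by simp
  also have "\<dots> = \<bar>det (matrix F)\<bar> * \<bar>det (matrix G)\<bar>" using prod by simp
  finally show ?thesis using prod by (smt (verit) mult_right_le_imp_le mult_not_zero abs_ge_zero)
qed

section \<open>Perturbations of the standard Gaussian\<close>

definition gauss_density :: "real^'n \<Rightarrow> real" where
  "gauss_density v = (\<Prod>i\<in>UNIV. std_normal_density (v $ i))"

lemma prod_cart_eq_prod_Basis:
  fixes v :: "real^'n"
  shows "(\<Prod>i\<in>UNIV. f (v $ i)) = (\<Prod>b\<in>Basis. f (v \<bullet> b))"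
proof -
  have B: "(Basis :: (real^'n) set) = range (\<lambda>i. axis i 1)" by (auto simp: Basis_vec_def)
  have "inj (\<lambda>i::'n. axis i (1::real))" by (auto simp: inj_on_def axis_eq_axis)
  then show ?thesis unfolding B by (simp add: prod.reindex inner_axis)
qed

lemma nn_integral_lborel_prod_cart:
  assumes "f \<in> borel_measurable borel"
  shows "(\<integral>\<^sup>+v. (\<Prod>i\<in>UNIV. f ((v::real^'n) $ i)) \<partial>lborel) = (\<integral>\<^sup>+x. f x \<partial>lborel) ^ CARD('n)"
  unfolding prod_cart_eq_prod_Basis using assms by (subst nn_integral_lborel_prod) auto

lemma gauss_density_eq: "gauss_density (v::real^'n) = (1 / sqrt (2 * pi)) ^ CARD('n) * exp (- (norm v)\<^sup>2 / 2)"
proof -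
  have "(\<Prod>i\<in>UNIV. exp (- (v $ i)\<^sup>2 / 2)) = exp (- (norm v)\<^sup>2 / 2)"
    by (simp add: exp_sum[symmetric] norm_vec_def L2_set_def sum_nonneg sum_negf[symmetric] sum_divide_distrib)
  then show ?thesis
    unfolding gauss_density_def std_normal_density_def prod.distrib by simp
qed

lemma gauss_density_pos: "gauss_density v > 0"
  by (simp add: gauss_density_def prod_pos normal_density_pos)

lemma borel_measurable_gauss_density[measurable]: "gauss_density \<in> borel_measurable borel"
  unfolding gauss_density_eq[abs_def] by measurable

lemma nn_integral_gauss_density: "(\<integral>\<^sup>+v. ennreal (gauss_density (v::real^'n)) \<partial>lborel) = 1"
proof -
  have "(\<integral>\<^sup>+v. ennreal (gauss_density (v::real^'n)) \<partial>lborel)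
      = (\<integral>\<^sup>+v. (\<Prod>i\<in>UNIV. ennreal (std_normal_density ((v::real^'n) $ i))) \<partial>lborel)"
    by (simp add: gauss_density_def prod_ennreal)
  also have "\<dots> = (\<integral>\<^sup>+x. ennreal (std_normal_density x) \<partial>lborel) ^ CARD('n)"
    by (rule nn_integral_lborel_prod_cart) simp
  also have "\<dots> = 1" by (simp add: nn_integral_eq_integral)
  finally show ?thesis .
qed

lemma integrable_gauss_density[simp]: "integrable lborel (gauss_density :: real^'n \<Rightarrow> real)"
  by (rule integrableI_nonneg) (auto simp: nn_integral_gauss_density less_imp_le[OF gauss_density_pos])

lemma integral_gauss_density[simp]: "(\<integral>v. gauss_density (v::real^'n) \<partial>lborel) = 1"
  by (rule integral_eq_nn_integral[THEN trans])
     (auto simp: nn_integral_gauss_density less_imp_le[OF gauss_density_pos])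

lemma integrable_exp_norm_quarter: "integrable lborel (\<lambda>v::real^'n. exp (- (norm v)\<^sup>2 / 4))"
proof (rule integrableI_nonneg)
  have "exp (- (norm v)\<^sup>2 / 4) = (\<Prod>i\<in>UNIV. exp (- (v $ i)\<^sup>2 / 4))" for v :: "real^'n"
    by (simp add: exp_sum[symmetric] norm_vec_def L2_set_def sum_nonneg sum_negf[symmetric] sum_divide_distrib)
  then have "(\<integral>\<^sup>+v. ennreal (exp (- (norm (v::real^'n))\<^sup>2 / 4)) \<partial>lborel)
      = (\<integral>\<^sup>+v. (\<Prod>i\<in>UNIV. ennreal (exp (- ((v::real^'n) $ i)\<^sup>2 / 4))) \<partial>lborel)"
    by (simp add: prod_ennreal)
  also have "\<dots> = (\<integral>\<^sup>+x. ennreal (exp (- x\<^sup>2 / 4)) \<partial>lborel) ^ CARD('n)"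
    by (rule nn_integral_lborel_prod_cart) simp
  finally have eq: "(\<integral>\<^sup>+v. ennreal (exp (- (norm (v::real^'n))\<^sup>2 / 4)) \<partial>lborel)
    = (\<integral>\<^sup>+x. ennreal (exp (- x\<^sup>2 / 4)) \<partial>lborel) ^ CARD('n)" .
  have "(\<integral>\<^sup>+x. ennreal (exp (- x\<^sup>2 / 4)) \<partial>lborel)
      = (\<integral>\<^sup>+x. ennreal (sqrt (4 * pi) * normal_density 0 (sqrt 2) x) \<partial>lborel)"
    by (simp add: normal_density_def)
  also have "\<dots> < \<infinity>"
    by (subst nn_integral_eq_integral) auto
  finally show "(\<integral>\<^sup>+v. ennreal (exp (- (norm (v::real^'n))\<^sup>2 / 4)) \<partial>lborel) < \<infinity>"
    unfolding eq by (simp add: power_less_top_ennreal)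
qed auto

text \<open>Half of the Gaussian exponent is spent on the growth, through
  \<open>1 + t \<le> 2 * exp (t\<^sup>2 / 4)\<close>; the other half keeps the product
  integrable.\<close>

lemma integrable_gauss_density_linear_growth:
  fixes f :: "real^'n \<Rightarrow> real"
  assumes [measurable]: "f \<in> borel_measurable borel" and f: "\<And>v. \<bar>f v\<bar> \<le> C * (1 + norm v)"
  shows "integrable lborel (\<lambda>v. f v * gauss_density v)"
proof (rule Bochner_Integration.integrable_bound)
  let ?c = "(1 / sqrt (2 * pi)) ^ CARD('n)"
  show "integrable lborel (\<lambda>v::real^'n. 2 * C * ?c * exp (- (norm v)\<^sup>2 / 4))"
    by (intro integrable_mult_right integrable_exp_norm_quarter)
  have C: "C \<ge> 0" using f[of 0] by simp
  show "AE v in lborel. norm (f v * gauss_density v) \<le> norm (2 * C * ?c * exp (- (norm v)\<^sup>2 / 4))"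
  proof (rule AE_I2)
    fix v :: "real^'n"
    let ?t = "norm v"
    have "0 \<le> (?t - 1)\<^sup>2" by simp
    then have "1 + ?t \<le> 2 * (1 + ?t\<^sup>2 / 4)" by (simp add: power2_eq_square algebra_simps)
    also have "\<dots> \<le> 2 * exp (?t\<^sup>2 / 4)" by (intro mult_left_mono exp_ge_add_one_self) auto
    finally have le: "1 + ?t \<le> 2 * exp (?t\<^sup>2 / 4)" .
    have "norm (f v * gauss_density v) = \<bar>f v\<bar> * (?c * exp (- ?t\<^sup>2 / 2))"
      by (simp add: gauss_density_eq abs_mult)
    also have "\<dots> \<le> (C * (2 * exp (?t\<^sup>2 / 4))) * (?c * exp (- ?t\<^sup>2 / 2))"
      using C by (intro mult_right_mono order_trans[OF f] mult_left_mono le) auto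
    also have "\<dots> = 2 * C * ?c * (exp (?t\<^sup>2 / 4) * exp (- ?t\<^sup>2 / 2))" by (simp add: mult_ac)
    also have "exp (?t\<^sup>2 / 4) * exp (- ?t\<^sup>2 / 2) = exp (- ?t\<^sup>2 / 4)" by (simp add: exp_add[symmetric])
    finally show "norm (f v * gauss_density v) \<le> norm (2 * C * ?c * exp (- ?t\<^sup>2 / 4))"
      using C by (simp add: abs_mult)
  qed
qed auto

lemma std_gauss_eq: "std_gauss = density lborel (\<lambda>v. ennreal (gauss_density v))"
  by (simp add: std_gauss_def gauss_density_def)

lemma sets_std_gauss[simp, measurable_cong]: "sets std_gauss = sets borel"
  by (simp add: std_gauss_eq)

lemma space_std_gauss[simp]: "space std_gauss = UNIV"
  by (simp add: std_gauss_eq)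

lemma prob_space_std_gauss: "prob_space std_gauss"
  by (rule prob_spaceI) (simp add: std_gauss_eq emeasure_density nn_integral_gauss_density)

lemma measure_std_gauss:
  assumes "S \<in> sets borel"
  shows "measure std_gauss S = (\<integral>v. indicator S v * gauss_density v \<partial>lborel)"
proof -
  have "emeasure std_gauss S = (\<integral>\<^sup>+v. ennreal (indicator S v * gauss_density v) \<partial>lborel)"
    using assms by (auto simp: std_gauss_eq emeasure_density intro!: nn_integral_cong split: split_indicator)
  then show ?thesis
    using assms by (simp add: measure_def integral_eq_nn_integral less_imp_le[OF gauss_density_pos])
qed

text \<open>Integrating \<open>F'\<close> along the segment from \<open>v\<close> to
  \<open>v + e\<close> gives \<open>F (v + e) - F v\<close>. Integration over \<open>v\<close> makes
  this difference vanish by translation invariance, while Fubini and translation invariance turn the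
  other side into the integral of \<open>F'\<close>.\<close>

lemma integral_directional_derivative_eq_0:
  fixes F F' :: "'a::euclidean_space \<Rightarrow> real"
  assumes F: "integrable lborel F" and F': "integrable lborel F'"
    and deriv: "\<And>v. ((\<lambda>r. F (v + r *\<^sub>R e)) has_real_derivative F' v) (at 0)"
  shows "(\<integral>v. F' v \<partial>lborel) = 0"
proof -
  have [measurable]: "F' \<in> borel_measurable borel" using F' by auto
  have transl: "integrable lborel (\<lambda>v. G (v + a))" "(\<integral>v. G (v + a) \<partial>lborel) = (\<integral>v. G v \<partial>lborel)"
    if "integrable lborel G" for G :: "'a \<Rightarrow> real" and a
  proof -
    have [measurable]: "G \<in> borel_measurable borel" using that by auto
    have "integrable (distr lborel borel ((+) a)) G" "integral\<^sup>L (distr lborel borel ((+) a)) G = integral\<^sup>L lborel G"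
      using that unfolding lborel_distr_plus by auto
    then show "integrable lborel (\<lambda>v. G (v + a))" "(\<integral>v. G (v + a) \<partial>lborel) = (\<integral>v. G v \<partial>lborel)"
      by (simp_all add: integrable_distr_eq integral_distr add.commute)
  qed
  define f where "f r v = indicator {0..1} r * F' (v + r *\<^sub>R e)" for r :: real and v
  have int: "integrable (lborel \<Otimes>\<^sub>M lborel) (case_prod f)"
  proof (rule lborel_pair.Fubini_integrable)
    show "case_prod f \<in> borel_measurable (lborel \<Otimes>\<^sub>M lborel)"
      unfolding f_def by measurable
    have eq: "(\<lambda>r. \<integral>v. norm (case (r, v) of (r, v) \<Rightarrow> f r v) \<partial>lborel)
        = (\<lambda>r. indicator {0..1} r * (\<integral>v. \<bar>F' v\<bar> \<partial>lborel))"
      using transl(2)[OF integrable_abs[OF F']] by (simp add: f_def abs_mult)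
    show "integrable lborel (\<lambda>r. \<integral>v. norm (case (r, v) of (r, v) \<Rightarrow> f r v) \<partial>lborel)"
      unfolding eq by (intro integrable_mult_left) auto
    show "AE r in lborel. integrable lborel (\<lambda>v. case (r, v) of (r, v) \<Rightarrow> f r v)"
      using transl(1)[OF F'] by (simp add: f_def)
  qed
  have "AE v in lborel. integrable lborel (\<lambda>r. f r v)"
    using lborel_pair.AE_integrable_snd[OF int] .
  then have "AE v in lborel. (\<integral>r. f r v \<partial>lborel) = F (v + e) - F v"
  proof eventually_elim
    case (elim v)
    have "((\<lambda>r. F (v + r *\<^sub>R e)) has_real_derivative F' (v + r *\<^sub>R e)) (at r)" for r
    proof -
      have "((\<lambda>s. F ((v + r *\<^sub>R e) + s *\<^sub>R e)) has_real_derivative F' (v + r *\<^sub>R e)) (at 0)"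
        by (rule deriv)
      then have "((\<lambda>s. (\<lambda>r. F (v + r *\<^sub>R e)) (s + r)) has_real_derivative F' (v + r *\<^sub>R e)) (at 0)"
        by (simp add: algebra_simps)
      then show ?thesis using DERIV_shift[of "\<lambda>r. F (v + r *\<^sub>R e)" _ 0 r] by simp
    qed
    \<comment> \<open>\<open>F'\<close> is not known to be continuous, so the fundamental theorem is
      used for the gauge integral. It agrees with the Lebesgue integral on the lines where the
      integrand is Lebesgue integrable, which are almost all of them.\<close>
    then have "((\<lambda>r. F' (v + r *\<^sub>R e)) has_integral (F (v + 1 *\<^sub>R e) - F (v + 0 *\<^sub>R e))) {0..1}"
      by (intro fundamental_theorem_of_calculus)
         (auto simp: has_real_derivative_iff_has_vector_derivative[symmetric] intro: DERIV_subset)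
    moreover have "set_integrable lborel {0..1} (\<lambda>r. F' (v + r *\<^sub>R e))"
      using elim by (simp add: set_integrable_def f_def)
    ultimately have "(LINT r : {0..1} | lborel. F' (v + r *\<^sub>R e)) = F (v + e) - F v"
      by (simp add: set_borel_integral_eq_integral integral_unique)
    then show ?case by (simp add: set_lebesgue_integral_def f_def)
  qed
  moreover have "(\<lambda>v. \<integral>r. f r v \<partial>lborel) \<in> borel_measurable lborel"
    using lborel_pair.integrable_snd[OF int] by auto
  ultimately have "(\<integral>v. (\<integral>r. f r v \<partial>lborel) \<partial>lborel) = (\<integral>v. F (v + e) - F v \<partial>lborel)"
    using borel_measurable_integrable[OF transl(1)[OF F, of e]] borel_measurable_integrable[OF F]
    by (intro integral_cong_AE borel_measurable_diff)
  also have "\<dots> = 0" using F transl[OF F] by simp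
  also have "(\<integral>v. (\<integral>r. f r v \<partial>lborel) \<partial>lborel) = (\<integral>r. (\<integral>v. f r v \<partial>lborel) \<partial>lborel)"
    by (rule lborel_pair.Fubini_integral[OF int])
  also have "\<dots> = (\<integral>v. F' v \<partial>lborel)"
    by (simp add: f_def transl(2)[OF F'])
  finally show ?thesis .
qed

text \<open>A directional derivative is a pointwise limit of difference quotients, which are
  continuous in \<open>v\<close>, although the limit may not be.\<close>

lemma borel_measurable_has_derivative:
  fixes f :: "'a::euclidean_space \<Rightarrow> 'b::euclidean_space"
  assumes "\<And>v. (f has_derivative f' v) (at v)"
  shows "(\<lambda>v. f' v u) \<in> borel_measurable borel"
proof (rule borel_measurable_LIMSEQ_metric)
  have cont: "continuous_on UNIV f"
    using assms by (rule has_derivative_continuous_on)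
  show "(\<lambda>v. real (Suc n) *\<^sub>R (f (v + inverse (real (Suc n)) *\<^sub>R u) - f v)) \<in> borel_measurable borel" for n
    by (intro borel_measurable_continuous_onI continuous_intros continuous_on_compose2[OF cont]) auto
  fix v
  have "((\<lambda>r. f (v + r *\<^sub>R u)) has_derivative (\<lambda>r. f' v (r *\<^sub>R u))) (at 0)"
    by (rule has_derivative_compose[of "\<lambda>r. v + r *\<^sub>R u" "\<lambda>r. r *\<^sub>R u" 0 UNIV f "f' v", simplified])
       (auto intro!: derivative_eq_intros assms)
  then have "((\<lambda>r. f (v + r *\<^sub>R u)) has_vector_derivative f' v u) (at 0)"
    using linear_cmul[OF has_derivative_linear[OF assms]] by (simp add: has_vector_derivative_def)
  then have "((\<lambda>r. norm (f (v + r *\<^sub>R u) - f v - r *\<^sub>R f' v u) / \<bar>r\<bar>) \<longlongrightarrow> 0) (at 0)"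
    by (simp add: has_vector_derivative_def has_derivative_iff_norm)
  then have "((\<lambda>r. norm ((f (v + r *\<^sub>R u) - f v) /\<^sub>R r - f' v u)) \<longlongrightarrow> 0) (at 0)"
  proof (rule Lim_transform_eventually)
    show "\<forall>\<^sub>F r in at 0. norm (f (v + r *\<^sub>R u) - f v - r *\<^sub>R f' v u) / \<bar>r\<bar> =
        norm ((f (v + r *\<^sub>R u) - f v) /\<^sub>R r - f' v u)"
      unfolding eventually_at_filter
    proof (intro always_eventually allI impI)
      fix r :: real assume r: "r \<noteq> 0"
      then have "(f (v + r *\<^sub>R u) - f v) /\<^sub>R r - f' v u = inverse r *\<^sub>R (f (v + r *\<^sub>R u) - f v - r *\<^sub>R f' v u)"
        by (simp add: scaleR_diff_right)
      then show "norm (f (v + r *\<^sub>R u) - f v - r *\<^sub>R f' v u) / \<bar>r\<bar> =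
          norm ((f (v + r *\<^sub>R u) - f v) /\<^sub>R r - f' v u)"
        by (simp add: divide_inverse mult.commute)
    qed
  qed
  then have "((\<lambda>r. (f (v + r *\<^sub>R u) - f v) /\<^sub>R r) \<longlongrightarrow> f' v u) (at 0)"
    by (simp add: tendsto_norm_zero_iff Lim_null[symmetric])
  moreover have "filterlim (\<lambda>n. inverse (real (Suc n))) (at 0) sequentially"
    using LIMSEQ_inverse_real_of_nat by (simp add: filterlim_at)
  ultimately have "(\<lambda>n. (f (v + inverse (real (Suc n)) *\<^sub>R u) - f v) /\<^sub>R inverse (real (Suc n))) \<longlonglongrightarrow> f' v u"
    by (rule filterlim_compose)
  then show "(\<lambda>n. real (Suc n) *\<^sub>R (f (v + inverse (real (Suc n)) *\<^sub>R u) - f v)) \<longlonglongrightarrow> f' v u"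
    by simp
qed

lemma change_of_variables_UNIV_real:
  fixes f :: "real^'n::{finite,wellorder} \<Rightarrow> real" and \<Phi> :: "real^'n::_ \<Rightarrow> real^'n::_"
  assumes "bij \<Phi>" and der: "\<And>v. (\<Phi> has_derivative \<Phi>' v) (at v)"
    and f: "integrable lborel f"
  shows "integrable lborel (\<lambda>v. \<bar>det (matrix (\<Phi>' v))\<bar> * f (\<Phi> v))"
    and "(\<integral>v. \<bar>det (matrix (\<Phi>' v))\<bar> * f (\<Phi> v) \<partial>lborel) = (\<integral>v. f v \<partial>lborel)"
proof -
  let ?g = "\<lambda>v. \<bar>det (matrix (\<Phi>' v))\<bar> * f (\<Phi> v)"
  have [measurable]: "f \<in> borel_measurable borel" using f by auto
  have "continuous_on UNIV \<Phi>"
    using der by (rule has_derivative_continuous_on)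
  then have [measurable]: "\<Phi> \<in> borel_measurable borel" by (rule borel_measurable_continuous_onI)
  \<comment> \<open>Borel measurability of the Jacobian determinant is what allows the return from
    the completed measure to \<open>lborel\<close> at the end.\<close>
  have "(\<lambda>v. \<Phi>' v (axis j 1) $ i) \<in> borel_measurable borel" for i j
    using borel_measurable_has_derivative[OF der, of "axis j 1"]
    by (simp add: cart_eq_inner_axis borel_measurable_inner)
  then have [measurable]: "(\<lambda>v. det (matrix (\<Phi>' v))) \<in> borel_measurable borel"
    unfolding det_def matrix_def by (simp add: borel_measurable_sum borel_measurable_prod)
  have g_meas: "?g \<in> borel_measurable borel" by measurable
  have surj: "\<Phi> ` UNIV = UNIV" using \<open>bij \<Phi>\<close> by (simp add: bij_def)
  \<comment> \<open>The scalar \<open>f\<close> is viewed as a function into \<open>real^1\<close>,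
    to which the change of variables theorem applies. The right side of the equivalence holds by
    integrability of \<open>f\<close>, so the left side is the gain.\<close>
  have "(\<lambda>v. \<bar>det (matrix (\<Phi>' v))\<bar> *\<^sub>R (vec (f (\<Phi> v)) :: real^1)) absolutely_integrable_on UNIV \<and>
      integral UNIV (\<lambda>v. \<bar>det (matrix (\<Phi>' v))\<bar> *\<^sub>R (vec (f (\<Phi> v)) :: real^1)) = vec (integral UNIV f)
    \<longleftrightarrow> (\<lambda>v. vec (f v) :: real^1) absolutely_integrable_on (\<Phi> ` UNIV) \<and>
      integral (\<Phi> ` UNIV) (\<lambda>v. vec (f v) :: real^1) = vec (integral UNIV f)"
    using der \<open>bij \<Phi>\<close>
    by (intro has_absolute_integral_change_of_variables[where f = "\<lambda>v. vec (f v) :: real^1"])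
       (auto simp: bij_def)
  then have iff: "?g absolutely_integrable_on UNIV \<and> integral UNIV ?g = integral UNIV f
      \<longleftrightarrow> f absolutely_integrable_on UNIV \<and> integral UNIV f = integral UNIV f"
    by (simp add: absolutely_integrable_on_1_iff integral_on_1_eq surj)
  have "f absolutely_integrable_on UNIV"
    using f by (simp add: set_integrable_def integrable_completion)
  with iff have g: "?g absolutely_integrable_on UNIV" "integral UNIV ?g = integral UNIV f" by auto
  show int: "integrable lborel ?g"
    using g(1) g_meas by (simp add: set_integrable_def integrable_completion)
  show "(\<integral>v. ?g v \<partial>lborel) = (\<integral>v. f v \<partial>lborel)"
    using g(2) by (simp add: integral_lborel[OF int] integral_lborel[OF f])
qed

text \<open>The divergence of \<open>b\<close> times the density integrates to zero, which is
  Stein's identity. Boundedness of \<open>b\<close> and \<open>b'\<close> leaves integrands of at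
  most linear growth times the density.\<close>

lemma gauss_integration_by_parts:
  fixes b :: "real^'n \<Rightarrow> real^'n"
  assumes der: "\<And>v. (b has_derivative b' v) (at v)"
    and bounded: "\<And>v. norm (b v) \<le> \<beta>" and bounded': "\<And>v u. norm (b' v u) \<le> \<kappa> * norm u"
  shows "integrable lborel (\<lambda>v. (v \<bullet> b v - (\<Sum>i\<in>UNIV. b' v (axis i 1) $ i)) * gauss_density v)"
    and "(\<integral>v. (v \<bullet> b v - (\<Sum>i\<in>UNIV. b' v (axis i 1) $ i)) * gauss_density v \<partial>lborel) = 0"
proof -
  \<comment> \<open>The density has \<open>i\<close>-th partial derivative \<open>- v $ i\<close>
    times itself, so \<open>F' i\<close> is the \<open>i\<close>-th partial derivative of
    \<open>b v $ i * gauss_density v\<close>.\<close>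
  define F' where "F' i v = (b' v (axis i 1) $ i - v $ i * b v $ i) * gauss_density v" for i v
  have "continuous_on UNIV b"
    using der by (rule has_derivative_continuous_on)
  then have b_meas: "b \<in> borel_measurable borel" by (rule borel_measurable_continuous_onI)
  have b0: "\<beta> \<ge> 0" using bounded[of 0] order_trans norm_ge_zero by blast
  have comp: "\<bar>b v $ i\<bar> \<le> \<beta>" for v i
    using component_le_norm_cart bounded order_trans by blast
  have comp': "\<bar>b' v (axis i 1) $ i\<bar> \<le> \<kappa>" for v i
    using order_trans[OF component_le_norm_cart bounded'[of v "axis i 1"]] by simp
  have k0: "\<kappa> \<ge> 0" using comp'[of 0 undefined] by linarith
  have [measurable]: "(\<lambda>v. b v $ i) \<in> borel_measurable borel" for i
    using b_meas by (simp add: cart_eq_inner_axis borel_measurable_inner)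
  have [measurable]: "(\<lambda>v. b' v (axis i 1) $ i) \<in> borel_measurable borel" for i
    using borel_measurable_has_derivative[OF der, of "axis i 1"]
    by (simp add: cart_eq_inner_axis borel_measurable_inner)
  have [measurable]: "(\<lambda>v::real^'n. v $ i) \<in> borel_measurable borel" for i
    by (simp add: cart_eq_inner_axis borel_measurable_inner)
  have int_F: "integrable lborel (\<lambda>v. b v $ i * gauss_density v)" for i
  proof (rule integrable_gauss_density_linear_growth)
    show "\<bar>b v $ i\<bar> \<le> \<beta> * (1 + norm v)" for v
      using comp[of v i] mult_left_mono[OF _ b0, of 1 "1 + norm v"] by simp
  qed measurable
  have int_F': "integrable lborel (F' i)" for i
    unfolding F'_def
  proof (rule integrable_gauss_density_linear_growth)
    show "\<bar>b' v (axis i 1) $ i - v $ i * b v $ i\<bar> \<le> (\<kappa> + \<beta>) * (1 + norm v)" for v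
    proof -
      have "\<bar>v $ i * b v $ i\<bar> \<le> norm v * \<beta>"
        unfolding abs_mult by (intro mult_mono component_le_norm_cart comp) auto
      then have "\<bar>v $ i * b v $ i\<bar> \<le> \<beta> * norm v" by (simp add: mult.commute)
      moreover have "0 \<le> \<kappa> * norm v" using k0 by simp
      ultimately show ?thesis using comp'[of v i] b0 unfolding ring_distribs by linarith
    qed
  qed measurable
  have zero: "(\<integral>v. F' i v \<partial>lborel) = 0" for i
  proof (rule integral_directional_derivative_eq_0[OF int_F int_F'])
    fix v :: "real^'n"
    let ?e = "axis i (1::real)" and ?c = "(1 / sqrt (2 * pi)) ^ CARD('n)"
    have line: "((\<lambda>r. v + r *\<^sub>R ?e) has_derivative (\<lambda>r. r *\<^sub>R ?e)) (at 0)"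
      by (auto intro!: derivative_eq_intros)
    have "((\<lambda>r. b (v + r *\<^sub>R ?e)) has_derivative (\<lambda>r. b' v (r *\<^sub>R ?e))) (at 0)"
      using has_derivative_compose[OF line, of b "b' v"] der[of v] by simp
    then have "((\<lambda>r. b (v + r *\<^sub>R ?e) $ i) has_derivative (\<lambda>r. b' v (r *\<^sub>R ?e) $ i)) (at 0)"
      by (rule bounded_linear.has_derivative[OF bounded_linear_vec_nth])
    then have 1: "((\<lambda>r. b (v + r *\<^sub>R ?e) $ i) has_real_derivative b' v ?e $ i) (at 0)"
      using linear_cmul[OF has_derivative_linear[OF der]]
      by (simp add: has_field_derivative_def mult_commute_abs)
    have sq: "(norm (v + r *\<^sub>R ?e))\<^sup>2 = (norm v)\<^sup>2 + 2 * r * v $ i + r\<^sup>2" for r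
      by (simp only: power2_norm_eq_inner inner_add_left inner_add_right)
         (simp add: inner_axis' inner_axis algebra_simps power2_eq_square)
    have 2: "((\<lambda>r. gauss_density (v + r *\<^sub>R ?e)) has_real_derivative (- (v $ i) * gauss_density v)) (at 0)"
      unfolding gauss_density_eq sq by (auto intro!: derivative_eq_intros)
    show "((\<lambda>r. b (v + r *\<^sub>R ?e) $ i * gauss_density (v + r *\<^sub>R ?e)) has_real_derivative F' i v) (at 0)"
      by (rule derivative_eq_intros 1 2 refl)+ (simp add: F'_def algebra_simps)
  qed
  have eq: "(v \<bullet> b v - (\<Sum>i\<in>UNIV. b' v (axis i 1) $ i)) * gauss_density v = - (\<Sum>i\<in>UNIV. F' i v)" for v
    by (simp add: F'_def inner_vec_def sum_subtractf[symmetric] sum_distrib_left sum_negf[symmetric] algebra_simps)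
  show "integrable lborel (\<lambda>v. (v \<bullet> b v - (\<Sum>i\<in>UNIV. b' v (axis i 1) $ i)) * gauss_density v)"
    unfolding eq using int_F' by auto
  show "(\<integral>v. (v \<bullet> b v - (\<Sum>i\<in>UNIV. b' v (axis i 1) $ i)) * gauss_density v \<partial>lborel) = 0"
    unfolding eq using int_F' zero by simp
qed

section \<open>Comparison of the Gaussian with its image under a perturbation of the
  identity\<close>

text \<open>AM-GM for \<open>q - p = (sqrt q - sqrt p) (sqrt q + sqrt p)\<close>, combined with \<open>sqrt (p q) \<ge> p (1 + l / 2)\<close>.\<close>

lemma abs_diff_le_affinity:
  fixes p q a l :: real
  assumes p: "p > 0" and q: "q \<ge> p * exp l" and a: "a > 0"
  shows "\<bar>q - p\<bar> \<le> a / 2 * (q - p - p * l) + (q + p) / a"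
proof -
  define s t where "s = sqrt p" and "t = sqrt q"
  have q0: "q \<ge> 0" using p q by (meson exp_ge_zero less_imp_le mult_nonneg_nonneg order_trans)
  have pq: "p = s\<^sup>2" "q = t\<^sup>2" "s \<ge> 0" "t \<ge> 0" using p q0 by (auto simp: s_def t_def)
  have sqrt_exp: "sqrt (exp l) = exp (l / 2)"
    by (rule real_sqrt_unique) (simp_all add: exp_double[symmetric])
  have "s\<^sup>2 * (1 + l / 2) \<le> s\<^sup>2 * exp (l / 2)"
    by (intro mult_left_mono exp_ge_add_one_self) auto
  also have "\<dots> = s * sqrt (p * exp l)"
    using pq(3) by (simp add: real_sqrt_mult s_def[symmetric] power2_eq_square sqrt_exp)
  also have "\<dots> \<le> s * t"
    unfolding t_def using q pq(3) by (intro mult_left_mono real_sqrt_le_mono) auto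
  finally have st: "p * (1 + l / 2) \<le> s * t" using pq by simp
  have "\<bar>q - p\<bar> = \<bar>t - s\<bar> * (t + s)"
    using pq by (simp add: power2_eq_square abs_mult[symmetric] square_diff_square_factored mult.commute)
       (metis abs_mult abs_of_nonneg add_nonneg_nonneg square_diff_square_factored mult.commute)
  also have "\<dots> \<le> a / 2 * (t - s)\<^sup>2 + (t + s)\<^sup>2 / (2 * a)"
  proof -
    have "0 \<le> (a * \<bar>t - s\<bar> - (t + s))\<^sup>2 / (2 * a)" using a by simp
    also have "\<dots> = a / 2 * (t - s)\<^sup>2 + (t + s)\<^sup>2 / (2 * a) - \<bar>t - s\<bar> * (t + s)"
      using a by (simp add: power2_diff power_mult_distrib field_simps power2_eq_square)
    finally show ?thesis by simp
  qed
  also have "\<dots> \<le> a / 2 * (q - p - p * l) + (q + p) / a"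
  proof (rule add_mono)
    have "(t - s)\<^sup>2 \<le> q - p - p * l"
      using st pq by (simp add: power2_diff algebra_simps)
    then show "a / 2 * (t - s)\<^sup>2 \<le> a / 2 * (q - p - p * l)"
      using a by (intro mult_left_mono) auto
    have "(t + s)\<^sup>2 \<le> 2 * (q + p)"
      using pq zero_le_power2[of "t - s"] by (simp add: power2_diff power2_sum)
    then have "(t + s)\<^sup>2 / (2 * a) \<le> (2 * (q + p)) / (2 * a)"
      using a by (intro divide_right_mono) auto
    then show "(t + s)\<^sup>2 / (2 * a) \<le> (q + p) / a"
      by (simp only: mult_divide_mult_cancel_left[OF zero_neq_numeral[symmetric]])
  qed
  finally show ?thesis .
qed

text \<open>A change of variables turns both measures into integrals, of the densities
  \<open>q\<close> and \<open>p\<close>, over the same set \<open>A\<close>. The log-ratio of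
  \<open>q\<close> to \<open>p\<close> is at least \<open>- w - D\<close>: here \<open>w\<close> is
  linear in the perturbation and has mean zero, and \<open>D\<close> collects the second order terms
  from the squared displacement and from the determinant.\<close>

lemma std_gauss_perturbation_wellorder:
  fixes \<Phi> :: "real^'n::{finite,wellorder} \<Rightarrow> real^'n::_" and \<beta> \<kappa> :: real
  assumes bij: "bij \<Phi>" and der: "\<And>v. (\<Phi> has_derivative \<Phi>' v) (at v)"
    and lin: "\<And>v. linear (\<Psi>' v)" and inv: "\<And>v u. \<Phi>' v (\<Psi>' v u) = u"
    and b: "\<And>v. norm (\<Phi> v - v) \<le> \<beta>"
    and bound: "\<And>v u. norm (\<Phi>' v u - u) \<le> \<kappa> * norm u"
    and bound_inv: "\<And>v u. norm (\<Psi>' v u - u) \<le> \<kappa> * norm u"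
    and D: "D = \<beta>\<^sup>2 / 2 + 3 * CARD('n) * \<kappa>\<^sup>2 / 2" "D > 0"
    and S: "S \<in> sets borel"
  shows "\<bar>measure std_gauss S - measure std_gauss (\<Phi> -` S)\<bar> \<le> sqrt D"
proof -
  define p q where "p v = gauss_density v" and "q v = \<bar>det (matrix (\<Phi>' v))\<bar> * gauss_density (\<Phi> v)" for v
  define A where "A = \<Phi> -` S"
  define w where "w v = v \<bullet> (\<Phi> v - v) - (\<Sum>i\<in>UNIV. (\<Phi>' v (axis i 1) - axis i 1) $ i)" for v
  have "continuous_on UNIV \<Phi>"
    using der by (rule has_derivative_continuous_on)
  then have "\<Phi> \<in> borel_measurable borel" by (rule borel_measurable_continuous_onI)
  then have A: "A \<in> sets borel" using measurable_sets[of \<Phi> borel borel S] S by (simp add: A_def)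
  have ind: "integrable lborel (\<lambda>v. indicator B v * f v)"
    if "B \<in> sets borel" "integrable lborel f" for B and f :: "real^'n::_ \<Rightarrow> real"
    using integrable_real_mult_indicator[of B lborel f] that by (simp add: mult.commute)
  have p: "integrable lborel p" "(\<integral>v. p v \<partial>lborel) = 1" by (simp_all add: p_def[abs_def])
  have q: "integrable lborel q" "(\<integral>v. q v \<partial>lborel) = 1"
    using change_of_variables_UNIV_real[OF bij der integrable_gauss_density] by (simp_all add: q_def[abs_def])
  have "(\<integral>v. indicator S v * gauss_density v \<partial>lborel)
      = (\<integral>v. \<bar>det (matrix (\<Phi>' v))\<bar> * (indicator S (\<Phi> v) * gauss_density (\<Phi> v)) \<partial>lborel)"
    using S by (intro change_of_variables_UNIV_real(2)[OF bij der, symmetric] ind) auto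
  also have "\<dots> = (\<integral>v. indicator A v * q v \<partial>lborel)"
    by (intro Bochner_Integration.integral_cong) (auto simp: q_def A_def split: split_indicator)
  finally have muS: "measure std_gauss S = (\<integral>v. indicator A v * q v \<partial>lborel)"
    by (simp add: measure_std_gauss S)
  have muA: "measure std_gauss A = (\<integral>v. indicator A v * p v \<partial>lborel)"
    by (simp add: measure_std_gauss A p_def)
  have ip: "integrable lborel (\<lambda>v. indicator A v * p v)" and iq: "integrable lborel (\<lambda>v. indicator A v * q v)"
    using A p q by (auto intro: ind)
  define \<Delta> where "\<Delta> = (\<integral>v. indicator A v * (q v - p v) \<partial>lborel)"
  have \<Delta>: "measure std_gauss S - measure std_gauss A = \<Delta>"
    using ip iq by (simp add: muS muA \<Delta>_def right_diff_distrib)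
  have i1: "integrable lborel (\<lambda>v. indicator A v * (q v - p v))"
    and i2: "integrable lborel (\<lambda>v. \<bar>q v - p v\<bar>)"
    using A p q by (auto intro: ind)
  \<comment> \<open>Since \<open>q - p\<close> has integral zero, its integral over \<open>A\<close> is at most half of its \<open>L\<^sup>1\<close> norm.\<close>
  have half: "2 * \<bar>\<Delta>\<bar> \<le> (\<integral>v. \<bar>q v - p v\<bar> \<partial>lborel)"
  proof -
    have "2 * \<Delta> = (\<integral>v. 2 * (indicator A v * (q v - p v)) - (q v - p v) \<partial>lborel)"
      using i1 p q by (simp add: \<Delta>_def)
    also have "\<bar>\<dots>\<bar> \<le> (\<integral>v. \<bar>2 * (indicator A v * (q v - p v)) - (q v - p v)\<bar> \<partial>lborel)"
      by (rule integral_abs_bound)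
    also have "\<dots> = (\<integral>v. \<bar>q v - p v\<bar> \<partial>lborel)"
      by (intro Bochner_Integration.integral_cong) (auto split: split_indicator)
    finally show ?thesis by simp
  qed
  \<comment> \<open>This choice minimizes \<open>a / 2 * D + 2 / a\<close>; the minimum is
    \<open>2 * sqrt D\<close>.\<close>
  define a where "a = 2 / sqrt D"
  have a: "a > 0" using D by (simp add: a_def)
  have pointwise: "\<bar>q v - p v\<bar> \<le> a / 2 * (q v - p v + w v * p v + D * p v) + (q v + p v) / a" for v
  proof -
    let ?tr = "\<Sum>i\<in>UNIV. (\<Phi>' v (axis i 1) - axis i 1) $ i"
    have "(norm (\<Phi> v - v))\<^sup>2 \<le> \<beta>\<^sup>2" using b by (intro power_mono) auto
    moreover have "(norm (\<Phi> v))\<^sup>2 = (norm v)\<^sup>2 + 2 * (v \<bullet> (\<Phi> v - v)) + (norm (\<Phi> v - v))\<^sup>2"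
      by (simp add: power2_norm_eq_inner inner_diff_left inner_diff_right inner_commute)
    ultimately have "- (v \<bullet> (\<Phi> v - v)) - \<beta>\<^sup>2 / 2 - (norm v)\<^sup>2 / 2 \<le> - (norm (\<Phi> v))\<^sup>2 / 2" by simp
    then have "exp (- (v \<bullet> (\<Phi> v - v)) - \<beta>\<^sup>2 / 2 - (norm v)\<^sup>2 / 2) \<le> exp (- (norm (\<Phi> v))\<^sup>2 / 2)" by simp
    then have g: "p v * exp (- (v \<bullet> (\<Phi> v - v)) - \<beta>\<^sup>2 / 2) \<le> gauss_density (\<Phi> v)"
      unfolding p_def gauss_density_eq
      by (simp add: mult.assoc exp_add[symmetric] algebra_simps)
    have det: "exp (?tr - 3 * CARD('n) * \<kappa>\<^sup>2 / 2) \<le> \<bar>det (matrix (\<Phi>' v))\<bar>"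
      by (rule abs_det_ge_exp_trace[OF has_derivative_linear[OF der] lin inv bound bound_inv])
    have "p v * exp (- w v - D) =
        exp (?tr - 3 * CARD('n) * \<kappa>\<^sup>2 / 2) * (p v * exp (- (v \<bullet> (\<Phi> v - v)) - \<beta>\<^sup>2 / 2))"
      by (simp add: w_def D(1) mult.left_commute exp_add[symmetric])
    also have "\<dots> \<le> q v"
      unfolding q_def by (intro mult_mono det g) (auto simp: p_def less_imp_le[OF gauss_density_pos])
    finally have "p v * exp (- w v - D) \<le> q v" .
    then have "\<bar>q v - p v\<bar> \<le> a / 2 * (q v - p v - p v * (- w v - D)) + (q v + p v) / a"
      by (intro abs_diff_le_affinity a) (auto simp: p_def gauss_density_pos)
    then show ?thesis by (simp add: algebra_simps)
  qed
  have der_b: "((\<lambda>v. \<Phi> v - v) has_derivative (\<lambda>u. \<Phi>' v u - u)) (at v)" for v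
    by (auto intro!: derivative_eq_intros der)
  have w: "integrable lborel (\<lambda>v. w v * p v)" "(\<integral>v. w v * p v \<partial>lborel) = 0"
    using gauss_integration_by_parts[OF der_b b bound] by (simp_all add: w_def p_def)
  have "2 * \<bar>\<Delta>\<bar> \<le> (\<integral>v. \<bar>q v - p v\<bar> \<partial>lborel)" by (rule half)
  also have "\<dots> \<le> (\<integral>v. a / 2 * (q v - p v + w v * p v + D * p v) + (q v + p v) / a \<partial>lborel)"
    using p q w by (intro integral_mono i2 pointwise) auto
  also have "\<dots> = a / 2 * D + 2 / a"
    using p q w by simp
  also have "\<dots> = 2 * sqrt D"
    using D(2) by (simp add: a_def real_div_sqrt)
  finally show ?thesis unfolding \<Delta>[symmetric] A_def by simp
qed

text \<open>The change of variables theorem is available for index types of class \<open>wellorder\<close> only;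
  an isomorphic copy of an arbitrary finite index type, ordered through an enumeration, lies in this class.\<close>

typedef 'a enumerated = "UNIV :: 'a set" ..

lemma bij_Rep_enumerated: "bij Rep_enumerated"
  by (metis Rep_enumerated_inject Abs_enumerated_inverse UNIV_I bijI')

lemma Abs_enumerated_inverse'[simp]: "Rep_enumerated (Abs_enumerated x) = x"
  by (simp add: Abs_enumerated_inverse)

lemma CARD_enumerated[simp]: "CARD('a enumerated) = CARD('a)"
  using bij_betw_same_card[OF bij_Rep_enumerated] .

instance enumerated :: (finite) finite
  by standard (metis bij_Rep_enumerated bij_betw_finite finite_code)

instantiation enumerated :: (finite) wellorder
begin

definition less_eq_enumerated :: "'a enumerated \<Rightarrow> 'a enumerated \<Rightarrow> bool" where
  "x \<le> y \<longleftrightarrow> to_nat (Rep_enumerated x) \<le> to_nat (Rep_enumerated y)"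

definition less_enumerated :: "'a enumerated \<Rightarrow> 'a enumerated \<Rightarrow> bool" where
  "x < y \<longleftrightarrow> to_nat (Rep_enumerated x) < to_nat (Rep_enumerated y)"

instance
proof
  fix P :: "'a enumerated \<Rightarrow> bool" and x
  assume step: "\<And>x. (\<And>y. y < x \<Longrightarrow> P y) \<Longrightarrow> P x"
  show "P x"
  proof (induction x rule: measure_induct_rule[of "\<lambda>x. to_nat (Rep_enumerated x)"])
    case (less x)
    show ?case by (rule step) (rule less, simp add: less_enumerated_def)
  qed
qed (auto simp: less_eq_enumerated_def less_enumerated_def Rep_enumerated_inject)

end

definition to_enumerated :: "real^'n \<Rightarrow> real^('n enumerated)" where
  "to_enumerated v = (\<chi> i. v $ Rep_enumerated i)"

definition of_enumerated :: "real^('n enumerated) \<Rightarrow> real^'n" where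
  "of_enumerated w = (\<chi> j. w $ Abs_enumerated j)"

lemma to_of_enumerated[simp]: "to_enumerated (of_enumerated w) = w"
  and of_to_enumerated[simp]: "of_enumerated (to_enumerated v) = v"
  by (simp_all add: to_enumerated_def of_enumerated_def vec_eq_iff Rep_enumerated_inverse)

lemma sum_enumerated: "(\<Sum>i\<in>UNIV. f (Rep_enumerated i)) = (\<Sum>j\<in>UNIV. f j)"
  by (rule sum.reindex_bij_betw[OF bij_Rep_enumerated])

lemma prod_enumerated: "(\<Prod>i\<in>UNIV. f (Rep_enumerated i)) = (\<Prod>j\<in>UNIV. f j)"
  by (rule prod.reindex_bij_betw[OF bij_Rep_enumerated])

lemma norm_to_enumerated[simp]: "norm (to_enumerated v) = norm v"
  by (simp add: norm_vec_def L2_set_def to_enumerated_def sum_enumerated[of "\<lambda>j. (v $ j)\<^sup>2"])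

lemma norm_of_enumerated[simp]: "norm (of_enumerated w) = norm w"
  using norm_to_enumerated[of "of_enumerated w"] by simp

lemma linear_to_enumerated: "linear to_enumerated" and linear_of_enumerated: "linear of_enumerated"
  by (auto intro!: linearI simp: to_enumerated_def of_enumerated_def vec_eq_iff)

lemma bounded_linear_enumerated: "bounded_linear to_enumerated" "bounded_linear of_enumerated"
  by (simp_all add: linear_to_enumerated linear_of_enumerated linear_conv_bounded_linear[symmetric])

lemma borel_measurable_of_enumerated[measurable]: "of_enumerated \<in> borel_measurable borel"
  by (intro borel_measurable_continuous_onI linear_continuous_on bounded_linear_enumerated)

text \<open>Relabelling coordinates maps boxes to boxes with the same side lengths, and the values
  on boxes determine \<open>lborel\<close>.\<close>

lemma lborel_distr_of_enumerated: "distr lborel borel of_enumerated = (lborel :: (real^'n) measure)"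
proof (rule lborel_eqI[symmetric])
  fix l u :: "real^'n"
  assume le: "\<And>b. b \<in> Basis \<Longrightarrow> l \<bullet> b \<le> u \<bullet> b"
  have le': "l $ j \<le> u $ j" for j using le[of "axis j 1"] by (simp add: inner_axis)
  have vimage: "of_enumerated -` box l u = box (to_enumerated l) (to_enumerated u)"
    by (auto simp: mem_box_cart of_enumerated_def to_enumerated_def)
       (metis Abs_enumerated_inverse' Rep_enumerated_inverse)+
  have prod: "(\<Prod>b\<in>Basis. (y - x) \<bullet> b) = (\<Prod>i\<in>UNIV. y $ i - x $ i)" for x y :: "real^'k"
    using prod_cart_eq_prod_Basis[of "\<lambda>t. t" "y - x"] by simp
  have "emeasure (distr lborel borel of_enumerated) (box l u) = emeasure lborel (box (to_enumerated l) (to_enumerated u))"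
    by (simp add: emeasure_distr vimage)
  also have "\<dots> = (\<Prod>b\<in>Basis. (to_enumerated u - to_enumerated l) \<bullet> b)"
  proof (subst emeasure_lborel_box)
    fix b :: "real^('n enumerated)" assume "b \<in> Basis"
    then show "to_enumerated l \<bullet> b \<le> to_enumerated u \<bullet> b"
      using le' by (auto simp: Basis_vec_def inner_axis to_enumerated_def)
  qed simp
  also have "(\<Prod>b\<in>Basis. (to_enumerated u - to_enumerated l) \<bullet> b) = (\<Prod>b\<in>Basis. (u - l) \<bullet> b)"
    unfolding prod by (simp add: to_enumerated_def prod_enumerated[of "\<lambda>j. u $ j - l $ j"])
  finally show "emeasure (distr lborel borel of_enumerated) (box l u) = ennreal (\<Prod>b\<in>Basis. (u - l) \<bullet> b)" .
qed simp

lemma measure_std_gauss_enumerated: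
  fixes S :: "(real^'n) set"
  assumes S: "S \<in> sets borel"
  shows "measure std_gauss S = measure std_gauss (of_enumerated -` S)"
proof -
  have S': "of_enumerated -` S \<in> sets borel"
    using measurable_sets[OF borel_measurable_of_enumerated S] by simp
  have gauss: "gauss_density (of_enumerated w) = gauss_density w" for w :: "real^('n enumerated)"
    by (simp add: gauss_density_eq)
  have "measure std_gauss S = (\<integral>v. indicator S v * gauss_density v \<partial>distr lborel borel of_enumerated)"
    by (simp add: measure_std_gauss S lborel_distr_of_enumerated)
  also have "\<dots> = (\<integral>w. indicator S (of_enumerated w) * gauss_density (of_enumerated w) \<partial>lborel)"
    using S by (intro integral_distr) auto
  also have "\<dots> = measure std_gauss (of_enumerated -` S)"
    by (simp add: measure_std_gauss S' gauss indicator_def)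
  finally show ?thesis .
qed

text \<open>Conjugation with the relabelling of coordinates, an isometry that preserves the
  Gaussian, reduces this to the well-ordered case.\<close>

theorem std_gauss_perturbation:
  fixes \<Phi> :: "real^'n \<Rightarrow> real^'n" and \<beta> \<kappa> :: real
  assumes bij: "bij \<Phi>" and der: "\<And>v. (\<Phi> has_derivative \<Phi>' v) (at v)"
    and lin: "\<And>v. linear (\<Psi>' v)" and inv: "\<And>v u. \<Phi>' v (\<Psi>' v u) = u"
    and b: "\<And>v. norm (\<Phi> v - v) \<le> \<beta>"
    and bound: "\<And>v u. norm (\<Phi>' v u - u) \<le> \<kappa> * norm u"
    and bound_inv: "\<And>v u. norm (\<Psi>' v u - u) \<le> \<kappa> * norm u"
    and D: "D = \<beta>\<^sup>2 / 2 + 3 * CARD('n) * \<kappa>\<^sup>2 / 2" "D > 0"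
    and S: "S \<in> sets borel"
  shows "\<bar>measure std_gauss S - measure std_gauss (\<Phi> -` S)\<bar> \<le> sqrt D"
proof -
  let ?\<Phi> = "\<lambda>w. to_enumerated (\<Phi> (of_enumerated w))"
  let ?\<Phi>' = "\<lambda>w u. to_enumerated (\<Phi>' (of_enumerated w) (of_enumerated u))"
  let ?\<Psi>' = "\<lambda>w u. to_enumerated (\<Psi>' (of_enumerated w) (of_enumerated u))"
  have conj: "norm (to_enumerated x - w) = norm (x - of_enumerated w)" for x :: "real^'n" and w
  proof -
    have "to_enumerated x - w = to_enumerated (x - of_enumerated w)"
      by (simp add: linear_diff[OF linear_to_enumerated])
    then show ?thesis by simp
  qed
  have "continuous_on UNIV \<Phi>" using der by (rule has_derivative_continuous_on)
  then have "\<Phi> \<in> borel_measurable borel" by (rule borel_measurable_continuous_onI)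
  then have S': "\<Phi> -` S \<in> sets borel" using measurable_sets[of \<Phi> borel borel S] S by simp
  have "\<bar>measure std_gauss (of_enumerated -` S) - measure std_gauss (?\<Phi> -` (of_enumerated -` S))\<bar> \<le> sqrt D"
  proof (rule std_gauss_perturbation_wellorder[where \<Phi>' = ?\<Phi>' and \<Psi>' = ?\<Psi>' and \<beta> = \<beta> and \<kappa> = \<kappa>])
    have "bij to_enumerated" "bij of_enumerated"
      by (metis bijI' to_of_enumerated of_to_enumerated)+
    then have "bij (to_enumerated \<circ> (\<Phi> \<circ> of_enumerated))" using bij by (intro bij_comp)
    then show "bij ?\<Phi>" by (simp add: o_def)
    show "(?\<Phi> has_derivative ?\<Phi>' w) (at w)" for w
      by (intro bounded_linear.has_derivative[OF bounded_linear_enumerated(1)]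
          has_derivative_compose[OF bounded_linear.has_derivative[OF bounded_linear_enumerated(2)]
            has_derivative_at_withinI[OF der]] has_derivative_ident)
    show "linear (?\<Psi>' w)" for w
      using linear_compose[OF linear_compose[OF linear_of_enumerated lin] linear_to_enumerated] by (simp add: o_def)
    show "of_enumerated -` S \<in> sets borel"
      using measurable_sets[OF borel_measurable_of_enumerated S] by simp
  qed (use inv b bound[of _ "of_enumerated _"] bound_inv[of _ "of_enumerated _"] D in \<open>simp_all add: conj\<close>)
  also have "?\<Phi> -` (of_enumerated -` S) = of_enumerated -` (\<Phi> -` S)" by auto
  finally show ?thesis by (simp add: measure_std_gauss_enumerated S S')
qed

section \<open>Stability of the Verlet integrator\<close>

text \<open>\<open>p k\<close> is the velocity half a step ahead of \<open>z k\<close>, so it has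
  received \<open>k + 1 / 2\<close> kicks. The sum of \<open>j + 1 / 2\<close> over
  \<open>j < k\<close> is exactly \<open>k\<^sup>2 / 2\<close>, which gives the constant of
  uniformly accelerated motion without an extra error depending on \<open>h\<close>.\<close>

lemma leapfrog_deviation:
  fixes z p a :: "nat \<Rightarrow> 'a::real_normed_vector"
  assumes z: "\<And>k. z (Suc k) = z k + h *\<^sub>R p k"
    and p: "\<And>k. p (Suc k) = p k - h *\<^sub>R a (Suc k)" and p0: "p 0 = v - (h / 2) *\<^sub>R a 0"
    and h: "h \<ge> 0" and a: "\<And>k. k \<le> n \<Longrightarrow> norm (a k) \<le> \<alpha>" and "k \<le> n"
  shows "norm (z k - z 0 - (real k * h) *\<^sub>R v) \<le> \<alpha> * (real k * h)\<^sup>2 / 2"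
proof -
  have dev_p: "norm (p k - v) \<le> h * \<alpha> * (real k + 1 / 2)" if "k \<le> n" for k
    using that
  proof (induction k)
    case 0
    then show ?case using mult_left_mono[OF a[of 0] h] h by (simp add: p0)
  next
    case (Suc k)
    have "norm (p (Suc k) - v) \<le> norm (p k - v) + norm (h *\<^sub>R a (Suc k))"
      unfolding p using norm_triangle_ineq4[of "p k - v" "h *\<^sub>R a (Suc k)"] by (simp add: algebra_simps)
    also have "\<dots> \<le> h * \<alpha> * (real k + 1 / 2) + h * \<alpha>"
      using Suc mult_left_mono[OF a[of "Suc k"] h] h by (intro add_mono) auto
    finally show ?case by (simp add: algebra_simps)
  qed
  show ?thesis
    using \<open>k \<le> n\<close>
  proof (induction k)
    case (Suc k)
    have "z (Suc k) - z 0 - (real (Suc k) * h) *\<^sub>R v = (z k - z 0 - (real k * h) *\<^sub>R v) + h *\<^sub>R (p k - v)"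
      by (simp add: z algebra_simps)
    then have "norm (z (Suc k) - z 0 - (real (Suc k) * h) *\<^sub>R v)
        \<le> norm (z k - z 0 - (real k * h) *\<^sub>R v) + norm (h *\<^sub>R (p k - v))"
      by (metis norm_triangle_ineq)
    also have "\<dots> \<le> \<alpha> * (real k * h)\<^sup>2 / 2 + h * (h * \<alpha> * (real k + 1 / 2))"
      using Suc mult_left_mono[OF dev_p[of k] h] h by (intro add_mono) auto
    also have "\<dots> = \<alpha> * (real (Suc k) * h)\<^sup>2 / 2"
      by (simp add: power2_eq_square field_simps)
    finally show ?case .
  qed simp
qed

text \<open>In place of a Gronwall argument, the maximum \<open>M\<close> of
  \<open>norm (z k)\<close> is bounded in terms of itself: the accelerations contribute at most
  \<open>M / 12 + \<gamma> * T\<^sup>2 / 2\<close>, and absorbing \<open>M / 12\<close> produces the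
  factor 12/11. The constant \<gamma> is an external forcing, zero for differences of trajectories
  and for linearizations, but not for differences of linearizations.\<close>

lemma leapfrog_stability:
  fixes z p a :: "nat \<Rightarrow> 'a::real_normed_vector"
  assumes z: "\<And>k. z (Suc k) = z k + h *\<^sub>R p k"
    and p: "\<And>k. p (Suc k) = p k - h *\<^sub>R a (Suc k)" and p0: "p 0 = v - (h / 2) *\<^sub>R a 0"
    and h: "h \<ge> 0" and a: "\<And>k. k \<le> n \<Longrightarrow> norm (a k) \<le> L * norm (z k) + \<gamma>"
    and L: "L \<ge> 0" and T: "T = real n * h" and LT: "L * T\<^sup>2 \<le> 1 / 6"
    and S: "S = norm (z 0) + T * norm v"
  shows "k \<le> n \<Longrightarrow> norm (z k) \<le> 12 / 11 * (S + \<gamma> * T\<^sup>2 / 2)"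
    and "norm (z n - z 0 - T *\<^sub>R v) \<le> S / 11 + 12 / 11 * (\<gamma> * T\<^sup>2 / 2)"
proof -
  define M where "M = Max ((\<lambda>k. norm (z k)) ` {..n})"
  have M: "norm (z k) \<le> M" if "k \<le> n" for k using that by (auto simp: M_def)
  have "M \<in> (\<lambda>k. norm (z k)) ` {..n}" unfolding M_def by (rule Max_in) auto
  then obtain m where m: "m \<le> n" "M = norm (z m)" by auto
  let ?\<alpha> = "L * M + \<gamma>"
  have bound: "norm (a k) \<le> ?\<alpha>" if "k \<le> n" for k
    using a[OF that] mult_left_mono[OF M[OF that] L] by linarith
  have \<alpha>0: "?\<alpha> \<ge> 0" using order_trans[OF norm_ge_zero bound[of 0]] by simp
  have T0: "T \<ge> 0" using h by (simp add: T)
  have dev: "norm (z k - z 0 - (real k * h) *\<^sub>R v) \<le> ?\<alpha> * T\<^sup>2 / 2" if "k \<le> n" for k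
  proof -
    have "?\<alpha> * (real k * h)\<^sup>2 / 2 \<le> ?\<alpha> * T\<^sup>2 / 2"
      unfolding T using that h \<alpha>0 by (intro divide_right_mono mult_left_mono power_mono mult_right_mono) auto
    then show ?thesis using leapfrog_deviation[OF z p p0 h bound that] by (rule order_trans[rotated]) simp
  qed
  have "?\<alpha> * T\<^sup>2 / 2 = (L * T\<^sup>2) * M / 2 + \<gamma> * T\<^sup>2 / 2" by (simp add: algebra_simps)
  also have "\<dots> \<le> (1 / 6) * M / 2 + \<gamma> * T\<^sup>2 / 2"
    using LT m by (intro add_right_mono divide_right_mono mult_right_mono) auto
  finally have \<alpha>: "?\<alpha> * T\<^sup>2 / 2 \<le> M / 12 + \<gamma> * T\<^sup>2 / 2" by simp
  have "real m * h * norm v \<le> T * norm v"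
    unfolding T using m h by (intro mult_right_mono) auto
  moreover have "norm (z m) \<le> norm (z m - z 0 - (real m * h) *\<^sub>R v) + (norm (z 0) + real m * h * norm v)"
  proof -
    have "z m = (z m - z 0 - (real m * h) *\<^sub>R v) + (z 0 + (real m * h) *\<^sub>R v)" by simp
    then have "norm (z m) \<le> norm (z m - z 0 - (real m * h) *\<^sub>R v) + norm (z 0 + (real m * h) *\<^sub>R v)"
      by (metis norm_triangle_ineq)
    also have "norm (z 0 + (real m * h) *\<^sub>R v) \<le> norm (z 0) + real m * h * norm v"
      using norm_triangle_ineq[of "z 0" "(real m * h) *\<^sub>R v"] h by simp
    finally show ?thesis by simp
  qed
  ultimately have "M \<le> M / 12 + \<gamma> * T\<^sup>2 / 2 + S"
    using dev[OF m(1)] \<alpha> m(2) by (simp add: S)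
  then have M_le: "M \<le> 12 / 11 * (S + \<gamma> * T\<^sup>2 / 2)" by simp
  then show "norm (z k) \<le> 12 / 11 * (S + \<gamma> * T\<^sup>2 / 2)" if "k \<le> n"
    using M[OF that] by simp
  show "norm (z n - z 0 - T *\<^sub>R v) \<le> S / 11 + 12 / 11 * (\<gamma> * T\<^sup>2 / 2)"
    using dev[of n] \<alpha> M_le by (simp add: T)
qed

section \<open>The leapfrog scheme, its flow map and the derivative in the velocity\<close>

locale leapfrog =
  fixes g :: "'a::euclidean_space \<Rightarrow> 'a" and H :: "'a \<Rightarrow> 'a \<Rightarrow> 'a" and L \<Lambda> h T :: real and n :: nat
  assumes deriv_g: "\<And>x. (g has_derivative H x) (at x)"
    and H_bound: "\<And>x u. norm (H x u) \<le> L * norm u"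
    and H_lipschitz: "\<And>x y u. norm (H x u - H y u) \<le> \<Lambda> * norm (x - y) * norm u"
    and L_nonneg: "L \<ge> 0" and \<Lambda>_nonneg: "\<Lambda> \<ge> 0" and h_pos: "h > 0" and T_pos: "T > 0"
    and T_def: "T = real n * h" and LT: "L * T\<^sup>2 \<le> 1 / 6"
begin

text \<open>The second component is the velocity after the first half kick of the next step. In this
  staggered form every kick but the initial one is full, which is the recursion treated by
  \<open>leapfrog_stability\<close>.\<close>

primrec traj :: "nat \<Rightarrow> 'a \<Rightarrow> 'a \<Rightarrow> 'a \<times> 'a" where
  "traj 0 x v = (x, v - (h / 2) *\<^sub>R g x)"
| "traj (Suc k) x v = (let q' = fst (traj k x v) + h *\<^sub>R snd (traj k x v)
     in (q', snd (traj k x v) - h *\<^sub>R g q'))"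

abbreviation "pos k x v \<equiv> fst (traj k x v)"
abbreviation "mom k x v \<equiv> snd (traj k x v)"

text \<open>This is the linearization of \<open>traj\<close> in the initial velocity, in direction
  \<open>u\<close>. The initial position stays fixed, hence the start \<open>(0, u)\<close>.\<close>

primrec dtraj :: "nat \<Rightarrow> 'a \<Rightarrow> 'a \<Rightarrow> 'a \<Rightarrow> 'a \<times> 'a" where
  "dtraj 0 x v u = (0, u)"
| "dtraj (Suc k) x v u = (let q' = fst (dtraj k x v u) + h *\<^sub>R snd (dtraj k x v u)
     in (q', snd (dtraj k x v u) - h *\<^sub>R H (pos (Suc k) x v) q'))"

abbreviation "dpos k x v u \<equiv> fst (dtraj k x v u)"
abbreviation "dmom k x v u \<equiv> snd (dtraj k x v u)"

lemma g_lipschitz: "norm (g x - g y) \<le> L * norm (x - y)"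
proof (rule differentiable_bound[of UNIV g H])
  show "onorm (H z) \<le> L" for z using H_bound L_nonneg by (intro onorm_le) auto
qed (auto intro: deriv_g)

lemma H_zero[simp]: "H x 0 = 0"
  using H_bound[of x 0] by simp

lemma H_diff: "H x u - H x w = H x (u - w)"
  by (simp add: linear_diff[OF has_derivative_linear[OF deriv_g]])

lemma has_derivative_traj:
  "(pos k x has_derivative dpos k x v) (at v) \<and> (mom k x has_derivative dmom k x v) (at v)"
proof (induction k)
  case 0
  show ?case by (auto intro!: derivative_eq_intros)
next
  case (Suc k)
  then have pos: "(pos k x has_derivative dpos k x v) (at v)" and mom: "(mom k x has_derivative dmom k x v) (at v)"
    by auto
  have 1: "(pos (Suc k) x has_derivative dpos (Suc k) x v) (at v)"
    using has_derivative_add[OF pos has_derivative_scaleR_right[OF mom, of h]] by (simp add: Let_def)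
  have "((\<lambda>v. g (pos (Suc k) x v)) has_derivative (\<lambda>u. H (pos (Suc k) x v) (dpos (Suc k) x v u))) (at v)"
    by (rule has_derivative_compose[OF 1 deriv_g])
  from has_derivative_diff[OF mom has_derivative_scaleR_right[OF this, of h]]
  have "(mom (Suc k) x has_derivative dmom (Suc k) x v) (at v)" by (simp add: Let_def)
  with 1 show ?case by blast
qed

lemmas has_derivative_pos = has_derivative_traj[THEN conjunct1]

lemma pos_lipschitz:
  assumes "k \<le> n"
  shows "norm (pos k x v - pos k y w) \<le> 12 / 11 * (norm (x - y) + T * norm (v - w))"
    and "norm (pos n x v - pos n y w - (x - y) - T *\<^sub>R (v - w)) \<le> (norm (x - y) + T * norm (v - w)) / 11"
proof -
  let ?z = "\<lambda>k. pos k x v - pos k y w" and ?a = "\<lambda>k. g (pos k x v) - g (pos k y w)"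
  let ?p = "\<lambda>k. mom k x v - mom k y w"
  have z: "?z (Suc k) = ?z k + h *\<^sub>R ?p k" for k by (simp add: Let_def algebra_simps)
  have p: "?p (Suc k) = ?p k - h *\<^sub>R ?a (Suc k)" for k by (simp add: Let_def algebra_simps)
  have p0: "?p 0 = (v - w) - (h / 2) *\<^sub>R ?a 0" by (simp add: algebra_simps)
  have a: "norm (?a k) \<le> L * norm (?z k) + 0" for k using g_lipschitz by simp
  have S: "norm (x - y) + T * norm (v - w) = norm (?z 0) + T * norm (v - w)" by simp
  note stab = leapfrog_stability[of ?z h ?p ?a, OF z p p0 less_imp_le[OF h_pos] a L_nonneg T_def LT S]
  show "norm (?z k) \<le> 12 / 11 * (norm (x - y) + T * norm (v - w))" using stab(1)[OF assms] by simp
  show "norm (pos n x v - pos n y w - (x - y) - T *\<^sub>R (v - w)) \<le> (norm (x - y) + T * norm (v - w)) / 11"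
    using stab(2) by simp
qed

lemma dpos_bound:
  assumes "k \<le> n"
  shows "norm (dpos k x v u) \<le> 12 / 11 * (T * norm u)"
    and "norm (dpos n x v u - T *\<^sub>R u) \<le> T * norm u / 11"
proof -
  let ?z = "\<lambda>k. dpos k x v u" and ?a = "\<lambda>k. H (pos k x v) (dpos k x v u)" and ?p = "\<lambda>k. dmom k x v u"
  have z: "?z (Suc k) = ?z k + h *\<^sub>R ?p k" for k by (simp add: Let_def)
  have p: "?p (Suc k) = ?p k - h *\<^sub>R ?a (Suc k)" for k by (simp add: Let_def)
  have p0: "?p 0 = u - (h / 2) *\<^sub>R ?a 0" by simp
  have a: "norm (?a k) \<le> L * norm (?z k) + 0" for k using H_bound by simp
  have S: "T * norm u = norm (?z 0) + T * norm u" by simp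
  note stab = leapfrog_stability[of ?z h ?p ?a, OF z p p0 less_imp_le[OF h_pos] a L_nonneg T_def LT S]
  show "norm (?z k) \<le> 12 / 11 * (T * norm u)" using stab(1)[OF assms] by simp
  show "norm (dpos n x v u - T *\<^sub>R u) \<le> T * norm u / 11" using stab(2) by simp
qed

text \<open>The difference of two linearizations starts from zero and is driven only by the change
  of \<open>H\<close> between the two trajectories. Two of the factors 12/11 bound the position gap
  and the linearization inside this forcing; the third comes from stability.\<close>

lemma dpos_lipschitz:
  "norm (dpos n x v u - dpos n y w u) \<le> (12 / 11) ^ 3 * \<Lambda> * (norm (x - y) + T * norm (v - w)) * T ^ 3 / 2 * norm u"
proof -
  let ?z = "\<lambda>k. dpos k x v u - dpos k y w u" and ?p = "\<lambda>k. dmom k x v u - dmom k y w u"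
  let ?a = "\<lambda>k. H (pos k x v) (dpos k x v u) - H (pos k y w) (dpos k y w u)"
  let ?S = "norm (x - y) + T * norm (v - w)"
  let ?\<gamma> = "\<Lambda> * (12 / 11 * ?S) * (12 / 11 * (T * norm u))"
  have z: "?z (Suc k) = ?z k + h *\<^sub>R ?p k" for k by (simp add: Let_def algebra_simps)
  have p: "?p (Suc k) = ?p k - h *\<^sub>R ?a (Suc k)" for k by (simp add: Let_def algebra_simps)
  have p0: "?p 0 = 0 - (h / 2) *\<^sub>R ?a 0" by simp
  have a: "norm (?a k) \<le> L * norm (?z k) + ?\<gamma>" if k: "k \<le> n" for k
  proof -
    have "?a k = H (pos k x v) (?z k) + (H (pos k x v) (dpos k y w u) - H (pos k y w) (dpos k y w u))"
      by (simp add: H_diff[symmetric])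
    then have "norm (?a k) \<le> norm (H (pos k x v) (?z k)) + norm (H (pos k x v) (dpos k y w u) - H (pos k y w) (dpos k y w u))"
      by (metis norm_triangle_ineq)
    also have "\<dots> \<le> L * norm (?z k) + \<Lambda> * norm (pos k x v - pos k y w) * norm (dpos k y w u)"
      by (intro add_mono H_bound H_lipschitz)
    also have "\<Lambda> * norm (pos k x v - pos k y w) * norm (dpos k y w u) \<le> ?\<gamma>"
      using \<Lambda>_nonneg T_pos by (intro mult_mono mult_left_mono pos_lipschitz(1) dpos_bound(1) k) auto
    finally show ?thesis by simp
  qed
  have S: "0 = norm (?z 0) + T * norm (0::'a)" by simp
  note stab = leapfrog_stability[of ?z h ?p ?a, OF z p p0 less_imp_le[OF h_pos] a L_nonneg T_def LT S]
  have "norm (?z n) \<le> 12 / 11 * (?\<gamma> * T\<^sup>2 / 2)" using stab(1)[of n] by simp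
  also have "\<dots> = (12 / 11) ^ 3 * \<Lambda> * ?S * T ^ 3 / 2 * norm u"
    by (simp add: power2_eq_square power3_eq_cube)
  finally show ?thesis .
qed

lemma pos_expansive: "10 / 11 * T * norm (v - w) \<le> norm (pos n x v - pos n x w)"
proof -
  have "norm (T *\<^sub>R (v - w)) \<le> norm (pos n x v - pos n x w) + norm (pos n x v - pos n x w - T *\<^sub>R (v - w))"
    using norm_triangle_ineq4[of "pos n x v - pos n x w" "pos n x v - pos n x w - T *\<^sub>R (v - w)"] by simp
  then show ?thesis using pos_lipschitz(2)[OF order_refl, of x v x w] T_pos by simp
qed

lemma bij_pos: "bij (pos n x)"
proof (rule bijI)
  show "inj (pos n x)"
  proof (rule injI)
    fix v w assume "pos n x v = pos n x w"
    then show "v = w" using pos_expansive[of v w x] T_pos by (simp add: mult_le_0_iff)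
  qed
  show "surj (pos n x)"
    unfolding surj_def
  proof
    fix y
    \<comment> \<open>A fixed point of \<open>?f\<close> is a preimage of \<open>y\<close>. Since
      \<open>pos n x\<close> differs from \<open>T\<close> times the identity by a map with
      Lipschitz constant \<open>T / 11\<close>, \<open>?f\<close> contracts by the factor
      1/11.\<close>
    let ?f = "\<lambda>v. v - (pos n x v - y) /\<^sub>R T"
    have "\<exists>!v. ?f v = v"
    proof (rule banach_fix_type[of "1 / 11"], safe)
      fix v w
      have "?f v - ?f w = - ((pos n x v - pos n x w - (x - x) - T *\<^sub>R (v - w)) /\<^sub>R T)"
        using T_pos by (simp add: algebra_simps)
      then have "norm (?f v - ?f w) = norm (pos n x v - pos n x w - (x - x) - T *\<^sub>R (v - w)) / T"
        using T_pos by (simp add: divide_inverse mult.commute)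
      also have "\<dots> \<le> (norm (x - x) + T * norm (v - w)) / 11 / T"
        using T_pos by (intro divide_right_mono pos_lipschitz(2)[OF order_refl]) auto
      finally show "dist (?f v) (?f w) \<le> 1 / 11 * dist v w"
        using T_pos by (simp add: dist_norm)
    qed auto
    then obtain v where "?f v = v" by auto
    then have "y = pos n x v" using T_pos by simp
    then show "\<exists>v. y = pos n x v" ..
  qed
qed

lemma dpos_inverse:
  obtains K where "linear K" "\<And>u. K (dpos n x v u) = u" "\<And>u. dpos n x v (K u) = u"
    "\<And>u. norm (K u) \<le> 11 / (10 * T) * norm u"
proof -
  have lin: "linear (dpos n x v)" by (rule has_derivative_linear[OF has_derivative_pos])
  have low: "10 / 11 * T * norm u \<le> norm (dpos n x v u)" for u
  proof -
    have "norm (T *\<^sub>R u) \<le> norm (dpos n x v u) + norm (dpos n x v u - T *\<^sub>R u)"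
      using norm_triangle_ineq4[of "dpos n x v u" "dpos n x v u - T *\<^sub>R u"] by simp
    then show ?thesis using dpos_bound(2)[OF order_refl, of x v u] T_pos by simp
  qed
  have "inj (dpos n x v)"
    unfolding linear_injective_0[OF lin]
  proof (intro allI impI)
    fix u assume "dpos n x v u = 0"
    then show "u = 0" using low[of u] T_pos by (simp add: mult_le_0_iff)
  qed
  then obtain K where K: "linear K" "\<And>u. K (dpos n x v u) = u" "\<And>u. dpos n x v (K u) = u"
    using linear_injective_isomorphism[OF lin] by blast
  have "norm (K u) \<le> 11 / (10 * T) * norm u" for u
    using low[of "K u"] T_pos by (simp add: K field_simps)
  with K that show ?thesis by blast
qed

text \<open>The matching map is \<open>inv (pos n y) \<circ> pos n x\<close>. Its derivative and the
  inverse of that derivative both compose the inverse of one \<open>dpos\<close> with another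
  \<open>dpos\<close> taken at a nearby point, so the single estimate \<open>perturb\<close> serves
  both.\<close>

theorem velocity_matching:
  obtains \<Phi> \<Phi>' \<Psi>' where "bij \<Phi>" "\<And>v. pos n y (\<Phi> v) = pos n x v"
    "\<And>v. (\<Phi> has_derivative \<Phi>' v) (at v)" "\<And>v. linear (\<Psi>' v)" "\<And>v u. \<Phi>' v (\<Psi>' v u) = u"
    "\<And>v. norm (\<Phi> v - v) \<le> 6 / 5 * norm (x - y) / T"
    "\<And>v u. norm (\<Phi>' v u - u) \<le> 2 * \<Lambda> * T\<^sup>2 * norm (x - y) * norm u"
    "\<And>v u. norm (\<Psi>' v u - u) \<le> 2 * \<Lambda> * T\<^sup>2 * norm (x - y) * norm u"
proof -
  define \<Phi> where "\<Phi> v = inv (pos n y) (pos n x v)" for v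
  have pos_inv: "pos n z (inv (pos n z) w) = w" for z w
    by (rule surj_f_inv_f[OF bij_is_surj[OF bij_pos]])
  have match: "pos n y (\<Phi> v) = pos n x v" for v by (simp add: \<Phi>_def pos_inv)
  have "bij (inv (pos n y) \<circ> pos n x)" by (intro bij_comp bij_pos bij_imp_bij_inv)
  then have bij: "bij \<Phi>" by (simp add: \<Phi>_def[abs_def] o_def)
  \<comment> \<open>With \<open>t = T * norm (\<Phi> v - v)\<close> and
    \<open>r = norm (x - y)\<close>, stability gives \<open>t \<le> r + (r + t) / 11\<close>, that
    is \<open>t \<le> 6 / 5 * r\<close>.\<close>
  have b: "T * norm (\<Phi> v - v) \<le> 6 / 5 * norm (x - y)" for v
  proof -
    have "norm ((x - y) + T *\<^sub>R (v - \<Phi> v)) \<le> (norm (x - y) + T * norm (v - \<Phi> v)) / 11"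
      using pos_lipschitz(2)[OF order_refl, of x v y "\<Phi> v"] norm_minus_cancel[of "(x - y) + T *\<^sub>R (v - \<Phi> v)"]
      by (simp add: match algebra_simps)
    moreover have "norm (T *\<^sub>R (v - \<Phi> v)) \<le> norm ((x - y) + T *\<^sub>R (v - \<Phi> v)) + norm (x - y)"
      using norm_triangle_ineq4[of "(x - y) + T *\<^sub>R (v - \<Phi> v)" "x - y"] by simp
    ultimately show ?thesis using T_pos by (simp add: norm_minus_commute)
  qed
  have "\<exists>K. linear K \<and> (\<forall>u. K (dpos n z v u) = u) \<and> (\<forall>u. dpos n z v (K u) = u) \<and>
      (\<forall>u. norm (K u) \<le> 11 / (10 * T) * norm u)" for z v
    by (rule dpos_inverse[of z v]) blast
  then obtain K where K: "\<And>z v. linear (K z v)" "\<And>z v u. K z v (dpos n z v u) = u"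
    "\<And>z v u. dpos n z v (K z v u) = u" "\<And>z v u. norm (K z v u) \<le> 11 / (10 * T) * norm u"
    by metis
  have cont: "continuous (at w) (inv (pos n y))" for w
  proof -
    have "(11 / (10 * T))-lipschitz_on UNIV (inv (pos n y))"
    proof (rule lipschitz_onI)
      fix w w'
      show "dist (inv (pos n y) w) (inv (pos n y) w') \<le> 11 / (10 * T) * dist w w'"
        using pos_expansive[of "inv (pos n y) w" "inv (pos n y) w'" y] T_pos
        by (simp add: pos_inv dist_norm field_simps)
    qed (use T_pos in auto)
    then show ?thesis
      using lipschitz_on_continuous_on continuous_on_eq_continuous_at open_UNIV by blast
  qed
  have der_inv: "(inv (pos n y) has_derivative K y (inv (pos n y) w)) (at w)" for w
    by (rule has_derivative_inverse_basic[OF has_derivative_pos[of n y] _ _ cont open_UNIV])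
       (auto simp: K(1,2) linear_conv_bounded_linear[symmetric] pos_inv fun_eq_iff)
  have der: "(\<Phi> has_derivative (\<lambda>u. K y (\<Phi> v) (dpos n x v u))) (at v)" for v
    using has_derivative_compose[OF has_derivative_pos der_inv, of n x v] by (simp add: \<Phi>_def[abs_def])
  have perturb: "norm (K z v (dpos n z' v' u) - u) \<le> 2 * \<Lambda> * T\<^sup>2 * norm (x - y) * norm u"
    if "norm (z' - z) = norm (x - y)" "norm (v' - v) \<le> 6 / 5 * norm (x - y) / T" for z z' v v' u
  proof -
    \<comment> \<open>The position gap contributes 1 and the velocity gap 6/5.\<close>
    have S: "norm (z' - z) + T * norm (v' - v) \<le> 11 / 5 * norm (x - y)"
      using that T_pos by (simp add: field_simps)
    have "K z v (dpos n z' v' u) - u = K z v (dpos n z' v' u - dpos n z v u)"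
      by (simp add: linear_diff[OF K(1)] K(2))
    then have "norm (K z v (dpos n z' v' u) - u) \<le> 11 / (10 * T) * norm (dpos n z' v' u - dpos n z v u)"
      using K(4) by simp
    also have "\<dots> \<le> 11 / (10 * T) * ((12 / 11) ^ 3 * \<Lambda> * (norm (z' - z) + T * norm (v' - v)) * T ^ 3 / 2 * norm u)"
      using T_pos by (intro mult_left_mono dpos_lipschitz) auto
    also have "\<dots> \<le> 11 / (10 * T) * ((12 / 11) ^ 3 * \<Lambda> * (11 / 5 * norm (x - y)) * T ^ 3 / 2 * norm u)"
      using T_pos \<Lambda>_nonneg S by (intro mult_left_mono mult_right_mono divide_right_mono) auto
    also have "\<dots> = (11 / 10 * (12 / 11) ^ 3 * (11 / 5) / 2) * (\<Lambda> * T\<^sup>2 * norm (x - y) * norm u)"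
      using T_pos by (simp add: power2_eq_square power3_eq_cube)
    \<comment> \<open>The numerical factor is about 1.57 and is rounded up to 2.\<close>
    also have "\<dots> \<le> 2 * (\<Lambda> * T\<^sup>2 * norm (x - y) * norm u)"
      using \<Lambda>_nonneg by (intro mult_right_mono) (auto simp: power3_eq_cube)
    finally show ?thesis by (simp add: mult.assoc)
  qed
  have b': "norm (\<Phi> v - v) \<le> 6 / 5 * norm (x - y) / T" for v
    using b[of v] T_pos by (simp add: field_simps)
  show ?thesis
  proof (rule that[OF bij match der])
    show "linear (\<lambda>u. K x v (dpos n y (\<Phi> v) u))" for v
      using linear_compose[OF has_derivative_linear[OF has_derivative_pos] K(1)] by (simp add: o_def)
    show "K y (\<Phi> v) (dpos n x v (K x v (dpos n y (\<Phi> v) u))) = u" for v u by (simp add: K)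
    show "norm (\<Phi> v - v) \<le> 6 / 5 * norm (x - y) / T" for v by (rule b')
    show "norm (K y (\<Phi> v) (dpos n x v u) - u) \<le> 2 * \<Lambda> * T\<^sup>2 * norm (x - y) * norm u" for v u
      using b'[of v] by (intro perturb) (auto simp: norm_minus_commute)
    show "norm (K x v (dpos n y (\<Phi> v) u) - u) \<le> 2 * \<Lambda> * T\<^sup>2 * norm (x - y) * norm u" for v u
      using b'[of v] by (intro perturb) (auto simp: norm_minus_commute)
  qed
qed

end

section \<open>Derivatives of the potential as vector fields\<close>

lemma has_derivative_fderiv:
  assumes "f differentiable_on UNIV"
  shows "(f has_derivative blinfun_apply (fderiv f x)) (at x)"
proof -
  have "(f has_derivative frechet_derivative f (at x)) (at x)"
    using assms frechet_derivative_works by (auto simp: differentiable_on_def)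
  then show ?thesis
    unfolding fderiv_def by (subst bounded_linear_Blinfun_apply) (auto intro: has_derivative_bounded_linear)
qed

definition riesz :: "('a::euclidean_space \<Rightarrow>\<^sub>L real) \<Rightarrow> 'a" where
  "riesz l = (\<Sum>b\<in>Basis. blinfun_apply l b *\<^sub>R b)"

lemma inner_riesz: "w \<bullet> riesz l = blinfun_apply l w"
proof -
  have "blinfun_apply l w = blinfun_apply l (\<Sum>b\<in>Basis. (w \<bullet> b) *\<^sub>R b)"
    by (simp add: euclidean_representation)
  then show ?thesis
    by (simp add: riesz_def inner_sum_right blinfun.sum_right blinfun.scaleR_right mult.commute)
qed

lemma norm_riesz_le: "norm (riesz l) \<le> norm l"
proof -
  have "norm (riesz l) * norm (riesz l) = blinfun_apply l (riesz l)"
    unfolding power2_eq_square[symmetric] power2_norm_eq_inner by (rule inner_riesz)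
  also have "\<dots> \<le> norm l * norm (riesz l)"
    using norm_blinfun[of l "riesz l"] by simp
  finally have le: "norm (riesz l) * norm (riesz l) \<le> norm l * norm (riesz l)" .
  show ?thesis
  proof (cases "riesz l = 0")
    case False
    then show ?thesis by (intro mult_right_le_imp_le[OF le]) simp
  qed simp
qed

lemma bounded_linear_riesz: "bounded_linear riesz"
proof (rule bounded_linear_intro)
  show "riesz (l + l') = riesz l + riesz l'" for l l' :: "'a \<Rightarrow>\<^sub>L real"
    by (simp add: riesz_def blinfun.add_left scaleR_add_left sum.distrib)
  show "riesz (c *\<^sub>R l) = c *\<^sub>R riesz l" for c and l :: "'a \<Rightarrow>\<^sub>L real"
    by (simp add: riesz_def blinfun.scaleR_left scaleR_sum_right)
  show "norm (riesz l) \<le> norm l * 1" for l :: "'a \<Rightarrow>\<^sub>L real"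
    by (simp add: norm_riesz_le)
qed

lemma grad_eq_riesz:
  assumes "U differentiable_on UNIV"
  shows "grad U x = riesz (fderiv U x)"
  unfolding grad_def
proof (rule the_equality)
  have der: "(U has_derivative blinfun_apply (fderiv U x)) (at x)" by (rule has_derivative_fderiv[OF assms])
  then show "GDERIV U x :> riesz (fderiv U x)" unfolding gderiv_def inner_riesz .
  fix g assume "GDERIV U x :> g"
  then have eq: "(\<lambda>w. w \<bullet> g) = blinfun_apply (fderiv U x)"
    unfolding gderiv_def using der by (rule has_derivative_unique)
  have "\<forall>w. w \<bullet> g = w \<bullet> riesz (fderiv U x)"
    unfolding inner_riesz using fun_cong[OF eq] by (rule allI)
  then show "g = riesz (fderiv U x)" by (rule vector_eq_ldot[THEN iffD1])
qed

text \<open>\<open>riesz\<close> does not increase norms, so the bounds on \<open>D2 U\<close> and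
  \<open>D3 U\<close> pass to the vector-valued Hessian; the mean value inequality turns the bound
  on \<open>D3 U\<close> into a Lipschitz constant.\<close>

lemma leapfrog_grad:
  fixes U :: "'a::euclidean_space \<Rightarrow> real"
  assumes U: "U differentiable_on UNIV" "fderiv U differentiable_on UNIV" "D2 U differentiable_on UNIV"
    and L: "\<And>x. norm (D2 U x) \<le> L" and \<Lambda>: "\<And>x. norm (D3 U x) \<le> \<Lambda>"
    and "h > 0" "T > 0" "T = real n * h" "L * T\<^sup>2 \<le> 1 / 6"
  shows "leapfrog (grad U) (\<lambda>x u. riesz (blinfun_apply (D2 U x) u)) L \<Lambda> h T n"
proof
  show "(grad U has_derivative (\<lambda>u. riesz (blinfun_apply (D2 U x) u))) (at x)" for x
    unfolding grad_eq_riesz[OF U(1), abs_def]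
    by (rule bounded_linear.has_derivative[OF bounded_linear_riesz has_derivative_fderiv[OF U(2)]])
  show "norm (riesz (blinfun_apply (D2 U x) u)) \<le> L * norm u" for x u
    using norm_riesz_le[of "blinfun_apply (D2 U x) u"] norm_blinfun[of "D2 U x" u]
      mult_right_mono[OF L[of x] norm_ge_zero[of u]] by linarith
  have lip: "norm (D2 U x - D2 U y) \<le> \<Lambda> * norm (x - y)" for x y
    by (rule differentiable_bound[of UNIV "D2 U" "\<lambda>x. blinfun_apply (D3 U x)"])
       (auto simp: norm_blinfun.rep_eq[symmetric] \<Lambda> has_derivative_fderiv[OF U(3)])
  show "norm (riesz (blinfun_apply (D2 U x) u) - riesz (blinfun_apply (D2 U y) u)) \<le> \<Lambda> * norm (x - y) * norm u" for x y u
  proof -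
    have "riesz (blinfun_apply (D2 U x) u) - riesz (blinfun_apply (D2 U y) u) = riesz (blinfun_apply (D2 U x - D2 U y) u)"
      by (simp add: blinfun.diff_left linear_diff[OF bounded_linear.linear[OF bounded_linear_riesz]])
    also have "norm \<dots> \<le> norm (blinfun_apply (D2 U x - D2 U y) u)" by (rule norm_riesz_le)
    also have "\<dots> \<le> norm (D2 U x - D2 U y) * norm u" by (rule norm_blinfun)
    also have "\<dots> \<le> \<Lambda> * norm (x - y) * norm u" by (intro mult_right_mono lip) auto
    finally show ?thesis .
  qed
  show "L \<ge> 0" "\<Lambda> \<ge> 0" using order_trans[OF norm_ge_zero L] order_trans[OF norm_ge_zero \<Lambda>] by auto
qed fact+

lemma verlet_eq_leapfrog:
  assumes "leapfrog (grad U) H L \<Lambda> h T n"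
  shows "verlet_position U T h x v = fst (leapfrog.traj (grad U) h n x v)"
proof -
  interpret leapfrog "grad U" H L \<Lambda> h T n by fact
  \<comment> \<open>\<open>mom k\<close> already contains the first half kick of the next step;
    undoing it recovers the Verlet velocity.\<close>
  have "(verlet_step U h ^^ k) (x, v) = (pos k x v, mom k x v + (h / 2) *\<^sub>R grad U (pos k x v))" for k
  proof (induction k)
    case (Suc k)
    then show ?case
      by (simp add: verlet_step_def Let_def algebra_simps power2_eq_square)
         (simp add: scaleR_add_left[symmetric])
  qed simp
  moreover have "nat \<lfloor>T / h\<rfloor> = n" using h_pos by (simp add: T_def)
  ultimately show ?thesis by (simp add: verlet_position_def)
qed

section \<open>Measurability and smoothing of the uHMC kernel\<close>

lemma continuous_verlet_position:
  assumes g: "continuous_on UNIV (grad U)"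
  shows "continuous_on UNIV (\<lambda>(x, v). verlet_position U T h x v)"
proof -
  have step: "continuous_on UNIV (verlet_step U h)"
    unfolding verlet_step_def Let_def case_prod_beta
    by (intro continuous_intros continuous_on_compose2[OF g]) auto
  have "continuous_on UNIV (verlet_step U h ^^ k)" for k
  proof (induction k)
    case (Suc k)
    then show ?case using continuous_on_compose2[OF step Suc] by (simp add: o_def)
  qed (simp add: id_def continuous_on_id)
  then have "continuous_on UNIV (\<lambda>z. fst ((verlet_step U h ^^ nat \<lfloor>T / h\<rfloor>) z))"
    by (rule continuous_on_fst)
  then show ?thesis by (simp add: verlet_position_def case_prod_beta)
qed

lemma uhmc_measurable:
  assumes "continuous_on UNIV (grad U)"
  shows "uhmc U T h \<in> borel \<rightarrow>\<^sub>M prob_algebra borel"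
  unfolding uhmc_def
proof (rule measurable_distr_prob_space2)
  show "(\<lambda>x. std_gauss) \<in> borel \<rightarrow>\<^sub>M prob_algebra borel"
    by (rule measurable_const) (simp add: space_prob_algebra prob_space_std_gauss)
  show "(\<lambda>(x, v). verlet_position U T h x v) \<in> borel \<Otimes>\<^sub>M borel \<rightarrow>\<^sub>M borel"
    unfolding borel_prod by (intro borel_measurable_continuous_onI continuous_verlet_position assms)
qed

text \<open>Started at \<open>y\<close> with velocity \<open>\<Phi> v\<close>, the integrator ends
  where it ends from \<open>x\<close> with velocity \<open>v\<close>. The velocities leading from
  \<open>x\<close> into \<open>A\<close> are thus the preimage under \<Phi> of those leading from
  \<open>y\<close> into \<open>A\<close>, and \<open>std_gauss_perturbation\<close> compares the two
  sets.\<close>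

theorem uhmc_lipschitz_TV:
  fixes U :: "real^'d \<Rightarrow> real"
  assumes lf: "leapfrog (grad U) H L \<Lambda> h T n" and A: "A \<in> sets borel"
  shows "\<bar>measure (uhmc U T h x) A - measure (uhmc U T h y) A\<bar>
    \<le> 3 / 2 * sqrt (1 / T\<^sup>2 + 27 * real CARD('d) * \<Lambda>\<^sup>2 * T ^ 4) * norm (x - y)"
proof (cases "x = y")
  case False
  interpret leapfrog "grad U" H L \<Lambda> h T n by (rule lf)
  let ?r = "norm (x - y)"
  have r: "?r > 0" using False by simp
  obtain \<Phi> \<Phi>' \<Psi>' where \<Phi>: "bij \<Phi>" "\<And>v. pos n y (\<Phi> v) = pos n x v"
    "\<And>v. (\<Phi> has_derivative \<Phi>' v) (at v)" "\<And>v. linear (\<Psi>' v)" "\<And>v u. \<Phi>' v (\<Psi>' v u) = u"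
    "\<And>v. norm (\<Phi> v - v) \<le> 6 / 5 * ?r / T"
    "\<And>v u. norm (\<Phi>' v u - u) \<le> 2 * \<Lambda> * T\<^sup>2 * ?r * norm u"
    "\<And>v u. norm (\<Psi>' v u - u) \<le> 2 * \<Lambda> * T\<^sup>2 * ?r * norm u"
    using velocity_matching[of y x] by blast
  have cont: "continuous_on UNIV (pos n z)" for z
    using has_derivative_pos by (rule has_derivative_continuous_on)
  then have meas: "pos n z \<in> std_gauss \<rightarrow>\<^sub>M borel" for z
    using borel_measurable_continuous_onI[OF cont, of z] by (simp cong: measurable_cong_sets)
  have uhmc: "measure (uhmc U T h z) A = measure std_gauss (pos n z -` A)" for z
    using measure_distr[OF meas A, of z] by (simp add: uhmc_def verlet_eq_leapfrog[OF lf, abs_def])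
  define D where "D = (6 / 5 * ?r / T)\<^sup>2 / 2 + 3 * CARD('d) * (2 * \<Lambda> * T\<^sup>2 * ?r)\<^sup>2 / 2"
  \<comment> \<open>Positivity of \<open>D\<close>, which the Gaussian estimate requires, is the
    reason for treating \<open>x = y\<close> separately.\<close>
  have "(6 / 5 * ?r / T)\<^sup>2 > 0" using r T_pos by (intro zero_less_power) auto
  then have D: "D > 0" unfolding D_def by (intro add_pos_nonneg) auto
  have "\<bar>measure std_gauss (pos n y -` A) - measure std_gauss (\<Phi> -` (pos n y -` A))\<bar> \<le> sqrt D"
    using measurable_sets[OF meas A, of y]
    by (intro std_gauss_perturbation[OF \<Phi>(1,3-8) D_def D]) auto
  also have "\<Phi> -` (pos n y -` A) = pos n x -` A" using \<Phi>(2) by auto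
  finally have TV: "\<bar>measure std_gauss (pos n y -` A) - measure std_gauss (pos n x -` A)\<bar> \<le> sqrt D" .
  have "D \<le> (3 / 2 * sqrt (1 / T\<^sup>2 + 27 * real CARD('d) * \<Lambda>\<^sup>2 * T ^ 4) * ?r)\<^sup>2"
  proof -
    have "(3 / 2 * sqrt (1 / T\<^sup>2 + 27 * real CARD('d) * \<Lambda>\<^sup>2 * T ^ 4) * ?r)\<^sup>2
        = 9 / 4 * (1 / T\<^sup>2 + 27 * real CARD('d) * \<Lambda>\<^sup>2 * T ^ 4) * ?r\<^sup>2"
    proof -
      have "(sqrt (1 / T\<^sup>2 + 27 * real CARD('d) * \<Lambda>\<^sup>2 * T ^ 4))\<^sup>2 = 1 / T\<^sup>2 + 27 * real CARD('d) * \<Lambda>\<^sup>2 * T ^ 4"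
        by (rule real_sqrt_pow2) simp
      moreover have "(3 / 2 * s * ?r)\<^sup>2 = 9 / 4 * s\<^sup>2 * ?r\<^sup>2" for s :: real by (simp add: power2_eq_square)
      ultimately show ?thesis by (simp only:)
    qed
    also have "\<dots> = 9 / 4 * (?r / T)\<^sup>2 + 243 / 4 * (real CARD('d) * \<Lambda>\<^sup>2 * T ^ 4 * ?r\<^sup>2)"
      by (simp add: algebra_simps power_divide)
    \<comment> \<open>The Gaussian estimate yields the constants 18/25 and 6, both below the claimed
      9/4 and 243/4.\<close>
    also have "\<dots> \<ge> 18 / 25 * (?r / T)\<^sup>2 + 6 * (real CARD('d) * \<Lambda>\<^sup>2 * T ^ 4 * ?r\<^sup>2)"
      by (intro add_mono mult_right_mono) auto
    also have "18 / 25 * (?r / T)\<^sup>2 + 6 * (real CARD('d) * \<Lambda>\<^sup>2 * T ^ 4 * ?r\<^sup>2) = D"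
      by (simp add: D_def power_mult_distrib power_divide)
    finally show ?thesis .
  qed
  then have "sqrt D \<le> 3 / 2 * sqrt (1 / T\<^sup>2 + 27 * real CARD('d) * \<Lambda>\<^sup>2 * T ^ 4) * ?r"
    by (intro real_le_lsqrt) auto
  with TV show ?thesis by (simp add: uhmc abs_minus_commute)
qed simp

section \<open>Kernels and Wasserstein couplings\<close>

lemma kernel_pow_measurable:
  assumes K: "K \<in> borel \<rightarrow>\<^sub>M prob_algebra borel"
  shows "kernel_pow K m \<in> borel \<rightarrow>\<^sub>M prob_algebra borel"
proof (induction m)
  case 0
  show ?case by simp
next
  case (Suc m)
  show ?case unfolding kernel_pow.simps by (rule measurable_bind_prob_space[OF K Suc])
qed

lemma bind_in_space_prob_algebra:
  assumes "M \<in> space (prob_algebra A)" "K \<in> A \<rightarrow>\<^sub>M prob_algebra B"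
  shows "M \<bind> K \<in> space (prob_algebra B)"
  using prob_space_bind'[OF assms] sets_bind'[OF assms] by (simp add: space_prob_algebra)

text \<open>\<open>kernel_pow\<close> performs its additional step first, whereas smoothing is
  applied in the last step.\<close>

lemma bind_kernel_pow_Suc:
  assumes K: "K \<in> borel \<rightarrow>\<^sub>M prob_algebra borel" and \<nu>: "\<nu> \<in> space (prob_algebra borel)"
  shows "\<nu> \<bind> kernel_pow K (Suc m) = (\<nu> \<bind> kernel_pow K m) \<bind> K"
proof -
  have meas: "L \<in> M \<rightarrow>\<^sub>M subprob_algebra borel"
    if "L \<in> borel \<rightarrow>\<^sub>M prob_algebra borel" "sets M = sets borel" for L :: "'a \<Rightarrow> 'a measure" and M
    using measurable_prob_algebraD[OF that(1)] that(2) by (simp cong: measurable_cong_sets)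
  have setsK: "sets (K x) = sets borel" for x
    using measurable_space[OF K, of x] by (simp add: space_prob_algebra)
  have comm: "kernel_pow K (Suc m) x = kernel_pow K m x \<bind> K" for m x
  proof (induction m arbitrary: x)
    case 0
    show ?case by (simp add: bind_return'' setsK bind_return[OF measurable_prob_algebraD[OF K]])
  next
    case (Suc m)
    have "kernel_pow K (Suc (Suc m)) x = K x \<bind> kernel_pow K (Suc m)"
      by (simp only: kernel_pow.simps(2)[of K "Suc m"])
    also have "kernel_pow K (Suc m) = (\<lambda>y. kernel_pow K m y \<bind> K)"
      using Suc.IH by (rule ext)
    also have "K x \<bind> (\<lambda>y. kernel_pow K m y \<bind> K) = (K x \<bind> kernel_pow K m) \<bind> K"
      by (rule bind_assoc[OF meas[OF kernel_pow_measurable[OF K] setsK] measurable_prob_algebraD[OF K], symmetric])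
    finally show ?case by simp
  qed
  have "kernel_pow K (Suc m) = (\<lambda>x. kernel_pow K m x \<bind> K)"
    using comm by (rule ext)
  then have "\<nu> \<bind> kernel_pow K (Suc m) = \<nu> \<bind> (\<lambda>x. kernel_pow K m x \<bind> K)"
    by (rule arg_cong)
  also have "\<dots> = (\<nu> \<bind> kernel_pow K m) \<bind> K"
    using \<nu> by (intro bind_assoc[symmetric, OF meas[OF kernel_pow_measurable[OF K]] measurable_prob_algebraD[OF K]])
      (simp add: space_prob_algebra)
  finally show ?thesis .
qed

lemma W1_le_swap: "W1 \<eta> \<nu> \<le> W1 \<nu> (\<eta> :: 'a::euclidean_space measure)"
  unfolding W1_def[of \<nu> \<eta>]
proof (rule INF_greatest)
  fix \<gamma> assume \<gamma>: "\<gamma> \<in> couplings \<nu> \<eta>"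
  let ?\<gamma> = "distr \<gamma> (borel \<Otimes>\<^sub>M borel) (\<lambda>(x, y). (y, x)) :: ('a \<times> 'a) measure"
  have sets: "sets \<gamma> = sets (borel \<Otimes>\<^sub>M borel)" and "prob_space \<gamma>"
    using \<gamma> by (auto simp: couplings_def space_prob_algebra)
  note [measurable_cong] = sets
  have "prob_space ?\<gamma>" by (rule prob_space.prob_space_distr[OF \<open>prob_space \<gamma>\<close>]) measurable
  then have "?\<gamma> \<in> couplings \<eta> \<nu>"
    using \<gamma> by (auto simp: couplings_def space_prob_algebra distr_distr o_def case_prod_beta)
  then have "W1 \<eta> \<nu> \<le> (\<integral>\<^sup>+ (x, y). ennreal (norm (x - y)) \<partial>?\<gamma>)"
    unfolding W1_def by (rule INF_lower)
  also have "\<dots> = (\<integral>\<^sup>+ (x, y). ennreal (norm (x - y)) \<partial>\<gamma>)"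
    by (subst nn_integral_distr) (auto simp: case_prod_unfold norm_minus_commute)
  finally show "W1 \<eta> \<nu> \<le> (\<integral>\<^sup>+ (x, y). ennreal (norm (x - y)) \<partial>\<gamma>)" .
qed

lemma W1_commute: "W1 \<eta> \<nu> = W1 \<nu> (\<eta> :: 'a::euclidean_space measure)"
  by (intro antisym W1_le_swap)

text \<open>Under a coupling, the difference of the two image measures on a set is the mean of the
  differences of \<open>K\<close> at the coupled points, hence at most \<open>C\<close> times the
  transport cost. This bound is uniform in the set and holds for every coupling.\<close>

lemma TV_bind_le_W1:
  fixes K :: "'a::euclidean_space \<Rightarrow> 'a measure"
  assumes K: "K \<in> borel \<rightarrow>\<^sub>M prob_algebra borel"
    and lip: "\<And>x y A. A \<in> sets borel \<Longrightarrow> \<bar>measure (K x) A - measure (K y) A\<bar> \<le> C * norm (x - y)"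
    and C: "C > 0"
  shows "ennreal (TV (\<nu> \<bind> K) (\<eta> \<bind> K)) \<le> ennreal C * W1 \<nu> \<eta>"
proof -
  let ?t = "TV (\<nu> \<bind> K) (\<eta> \<bind> K)"
  \<comment> \<open>Dividing by \<open>C\<close> leaves a bare infimum on the right, so couplings
    can be treated one at a time.\<close>
  have "ennreal (?t / C) \<le> W1 \<nu> \<eta>"
    unfolding W1_def
  proof (rule INF_greatest)
    fix \<gamma> assume \<gamma>: "\<gamma> \<in> couplings \<nu> \<eta>"
    then have sets[measurable_cong]: "sets \<gamma> = sets (borel \<Otimes>\<^sub>M borel)" and "prob_space \<gamma>"
      and \<nu>: "\<nu> = distr \<gamma> borel fst" and \<eta>: "\<eta> = distr \<gamma> borel snd"
      by (auto simp: couplings_def space_prob_algebra)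
    interpret prob_space \<gamma> by fact
    let ?cost = "\<integral>\<^sup>+ (x, y). ennreal (norm (x - y)) \<partial>\<gamma>"
    have meas: "(\<lambda>x. measure (K x) A) \<in> borel_measurable borel" if "A \<in> sets borel" for A
      using measurable_compose[OF K measurable_measure_prob_algebra[OF that]] .
    have prob_K: "prob_space (K x)" for x
      using measurable_space[OF K, of x] by (simp add: space_prob_algebra)
    have diff: "ennreal \<bar>measure (\<nu> \<bind> K) A - measure (\<eta> \<bind> K) A\<bar> \<le> ennreal C * ?cost"
      if A: "A \<in> sets borel" for A
    proof -
      note [measurable] = meas[OF A]
      have bind: "measure (distr \<gamma> borel f \<bind> K) A = (\<integral>z. measure (K (f z)) A \<partial>\<gamma>)"
        if f: "f \<in> \<gamma> \<rightarrow>\<^sub>M borel" for f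
      proof -
        interpret f: prob_space "distr \<gamma> borel f" by (rule prob_space_distr[OF f])
        have "measure (distr \<gamma> borel f \<bind> K) A = (\<integral>x. measure (K x) A \<partial>distr \<gamma> borel f)"
          using measurable_prob_algebraD[OF K] A by (intro f.measure_bind) auto
        also have "\<dots> = (\<integral>z. measure (K (f z)) A \<partial>\<gamma>)"
          by (rule integral_distr[OF f meas[OF A]])
        finally show ?thesis .
      qed
      have int: "integrable \<gamma> (\<lambda>z. measure (K (f z)) A)" if f[measurable]: "f \<in> \<gamma> \<rightarrow>\<^sub>M borel" for f
        by (rule integrable_const_bound[of _ 1])
           (auto simp: prob_space.prob_le_1[OF prob_K])
      have fs: "fst \<in> \<gamma> \<rightarrow>\<^sub>M borel" "snd \<in> \<gamma> \<rightarrow>\<^sub>M borel" by measurable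
      have "measure (\<nu> \<bind> K) A - measure (\<eta> \<bind> K) A = (\<integral>z. measure (K (fst z)) A - measure (K (snd z)) A \<partial>\<gamma>)"
        unfolding \<nu> \<eta> bind[OF fs(1)] bind[OF fs(2)] using int[OF fs(1)] int[OF fs(2)] by simp
      also have "\<bar>\<dots>\<bar> \<le> (\<integral>z. \<bar>measure (K (fst z)) A - measure (K (snd z)) A\<bar> \<partial>\<gamma>)"
        by (rule integral_abs_bound)
      finally have "ennreal \<bar>measure (\<nu> \<bind> K) A - measure (\<eta> \<bind> K) A\<bar>
          \<le> ennreal (\<integral>z. \<bar>measure (K (fst z)) A - measure (K (snd z)) A\<bar> \<partial>\<gamma>)" by (rule ennreal_leI)
      also have "\<dots> = (\<integral>\<^sup>+z. ennreal \<bar>measure (K (fst z)) A - measure (K (snd z)) A\<bar> \<partial>\<gamma>)"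
        using int[OF fs(1)] int[OF fs(2)] by (intro nn_integral_eq_integral[symmetric]) auto
      also have "\<dots> \<le> (\<integral>\<^sup>+z. ennreal C * ennreal (norm (fst z - snd z)) \<partial>\<gamma>)"
        using lip[OF A] C by (intro nn_integral_mono) (simp add: ennreal_mult[symmetric] ennreal_leI)
      also have "\<dots> = ennreal C * ?cost"
        by (subst nn_integral_cmult) (auto simp: case_prod_unfold)
      finally show ?thesis .
    qed
    show "ennreal (?t / C) \<le> ?cost"
    proof (cases "?cost = \<top>")
      case False
      then obtain r where r: "?cost = ennreal r" "r \<ge> 0" by (cases ?cost) auto
      have "?t \<le> C * r"
        unfolding TV_def
      proof (rule cSUP_least)
        show "sets (borel :: 'a measure) \<noteq> {}" by blast
        fix A :: "'a set" assume "A \<in> sets borel"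
        from diff[OF this] show "\<bar>measure (\<nu> \<bind> K) A - measure (\<eta> \<bind> K) A\<bar> \<le> C * r"
          using C r by (simp add: ennreal_mult[symmetric] ennreal_le_iff)
      qed
      then have "?t / C \<le> r" using C by (simp add: pos_divide_le_eq mult.commute)
      then show ?thesis unfolding r(1) by (rule ennreal_leI)
    qed simp
  qed
  then have "ennreal C * ennreal (?t / C) \<le> ennreal C * W1 \<nu> \<eta>" by (rule mult_left_mono) simp
  then show ?thesis using C by (simp add: ennreal_mult'[symmetric])
qed

text \<open>The maximum with 1 accounts for initial laws close to equilibrium: the logarithm can
  then be very negative, and it is \<open>- \<infinity>\<close> if
  \<open>W1 \<mu>' \<nu> = 0\<close>, whereas a mixing time is nonnegative. The argument always
  spends one step on smoothing, so its bound never falls below 1. Extended arithmetic also covers an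
  infinite distance.\<close>

theorem corollary6:
  fixes U :: "real ^ 'd \<Rightarrow> real"
    and L L\<^sub>H L\<^sub>I T h M\<^sub>1 M\<^sub>2 c \<epsilon> :: real
    and \<mu>' \<nu> :: "(real ^ 'd) measure"
  assumes "C4 U"
    and "integrable lborel (\<lambda>x. exp (- U x))"
    and "\<And>x. U 0 \<le> U x" and "U 0 = 0"
    and "bdd_above (range (\<lambda>x. norm (D2 U x)))" and "L = (SUP x. norm (D2 U x))"
    and "bdd_above (range (\<lambda>x. norm (D3 U x)))" and "L\<^sub>H = (SUP x. norm (D3 U x))"
    and "bdd_above (range (\<lambda>x. norm (D4 U x)))" and "L\<^sub>I = (SUP x. norm (D4 U x))"
    and "T > 0" and "h > 0" and "T / h \<in> \<nat>"
    and "L * (T\<^sup>2 + T * h) \<le> 1 / 6"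
    and "\<mu>' \<in> space (prob_algebra borel)"
    and invariant: "\<mu>' \<bind> uhmc U T h = \<mu>'"
    and "M\<^sub>1 > 0" and "c > 0"
    and A5: "\<And>m \<eta>. \<eta> \<in> space (prob_algebra borel) \<Longrightarrow>
      W1 (\<eta> \<bind> kernel_pow (uhmc U T h) m) \<mu>' \<le> ennreal (M\<^sub>1 * exp (- c * real m)) * W1 \<eta> \<mu>'"
    and "M\<^sub>2 > 0"
    and A6: "W1 (gibbs U) \<mu>' \<le> ennreal (M\<^sub>2 * h\<^sup>2)"
    and "\<epsilon> > 0"
    and "\<nu> \<in> space (prob_algebra borel)"
  shows "t_mix (uhmc U T h) \<mu>' \<epsilon> \<nu> \<le>
    max 1 (2 + ereal (1 / c) *
      ln_ennreal (ennreal (3 * sqrt (1 / T\<^sup>2 + 27 * real CARD('d) * L\<^sub>H\<^sup>2 * T ^ 4) * M\<^sub>1) * W1 \<mu>' \<nu>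
        / ennreal (2 * \<epsilon>)))"
proof -
  let ?K = "uhmc U T h"
  define R where "R = sqrt (1 / T\<^sup>2 + 27 * real CARD('d) * L\<^sub>H\<^sup>2 * T ^ 4)"
  have "1 / T\<^sup>2 + 27 * real CARD('d) * L\<^sub>H\<^sup>2 * T ^ 4 > 0"
    using \<open>T > 0\<close> by (intro add_pos_nonneg) auto
  then have R: "R > 0" by (simp add: R_def)
  obtain n where "T / h = real n" using \<open>T / h \<in> \<nat>\<close> by (auto elim: Nats_cases)
  then have n: "T = real n * h" using \<open>h > 0\<close> by (simp add: field_simps)
  have L: "norm (D2 U x) \<le> L" and L\<^sub>H: "norm (D3 U x) \<le> L\<^sub>H" for x
    using assms(5-8) by (auto intro: cSUP_upper)
  have "L \<ge> 0" using order_trans[OF norm_ge_zero L] .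
  then have "L * T\<^sup>2 \<le> L * (T\<^sup>2 + T * h)" using \<open>T > 0\<close> \<open>h > 0\<close> by (intro mult_left_mono) auto
  then have LT: "L * T\<^sup>2 \<le> 1 / 6" using assms(14) by linarith
  have diff: "U differentiable_on UNIV" "fderiv U differentiable_on UNIV" "D2 U differentiable_on UNIV"
    using \<open>C4 U\<close> by (auto simp: C4_def)
  note lf = leapfrog_grad[OF diff L L\<^sub>H \<open>h > 0\<close> \<open>T > 0\<close> n LT]
  have "continuous_on UNIV (grad U)"
    using leapfrog.deriv_g[OF lf] by (rule has_derivative_continuous_on)
  then have K: "?K \<in> borel \<rightarrow>\<^sub>M prob_algebra borel" by (rule uhmc_measurable)
  \<comment> \<open>(A5) acts on the first \<open>m\<close> steps and the last step converts
    \<open>W1\<close> into total variation; by invariance \<mu>' is its own image under that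
    step.\<close>
  have contraction: "ennreal (TV \<mu>' (\<nu> \<bind> kernel_pow ?K (Suc m)))
      \<le> ennreal (3 / 2 * R) * (ennreal (M\<^sub>1 * exp (- c * real m)) * W1 \<mu>' \<nu>)" for m
  proof -
    have "ennreal (TV (\<mu>' \<bind> ?K) ((\<nu> \<bind> kernel_pow ?K m) \<bind> ?K))
        \<le> ennreal (3 / 2 * R) * W1 \<mu>' (\<nu> \<bind> kernel_pow ?K m)"
      using uhmc_lipschitz_TV[OF lf] R by (intro TV_bind_le_W1[OF K]) (auto simp: R_def)
    also have "\<dots> \<le> ennreal (3 / 2 * R) * (ennreal (M\<^sub>1 * exp (- c * real m)) * W1 \<mu>' \<nu>)"
      using A5[OF \<open>\<nu> \<in> _\<close>, of m] by (intro mult_left_mono) (simp_all add: W1_commute[of \<mu>'])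
    finally show ?thesis by (simp only: invariant bind_kernel_pow_Suc[OF K \<open>\<nu> \<in> _\<close>])
  qed
  have t_mix_le: "t_mix ?K \<mu>' \<epsilon> \<nu> \<le> ereal (real m)" if "TV \<mu>' (\<nu> \<bind> kernel_pow ?K m) \<le> \<epsilon>" for m
    unfolding t_mix_def using that by (intro INF_lower) simp
  show ?thesis
  proof (cases "W1 \<mu>' \<nu>")
    case top
    \<comment> \<open>An infinite distance makes the claimed bound infinite.\<close>
    have "ennreal (3 * R * M\<^sub>1) * W1 \<mu>' \<nu> / ennreal (2 * \<epsilon>) = \<infinity>"
      using R \<open>M\<^sub>1 > 0\<close> \<open>\<epsilon> > 0\<close> by (simp add: top ennreal_mult_top ennreal_top_divide)
    then show ?thesis using \<open>c > 0\<close> by (simp add: R_def ln_ennreal_def)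
  next
    case (real w)
    \<comment> \<open>The argument of the logarithm, normalized so that the total variation after
      \<open>Suc m\<close> steps is at most
      \<open>Y * exp (- c * real m) * \<epsilon>\<close>.\<close>
    define Y where "Y = 3 * R * M\<^sub>1 * w / (2 * \<epsilon>)"
    have Y0: "Y \<ge> 0" using R \<open>M\<^sub>1 > 0\<close> \<open>\<epsilon> > 0\<close> real by (simp add: Y_def)
    have Y: "ennreal (3 * R * M\<^sub>1) * W1 \<mu>' \<nu> / ennreal (2 * \<epsilon>) = ennreal Y"
      using R \<open>M\<^sub>1 > 0\<close> \<open>\<epsilon> > 0\<close> real by (simp add: Y_def ennreal_mult'[symmetric] divide_ennreal)
    have TV_le: "TV \<mu>' (\<nu> \<bind> kernel_pow ?K (Suc m)) \<le> Y * exp (- c * real m) * \<epsilon>" for m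
    proof -
      have "ennreal (3 / 2 * R) * (ennreal (M\<^sub>1 * exp (- c * real m)) * W1 \<mu>' \<nu>)
          = ennreal (3 / 2 * R * (M\<^sub>1 * exp (- c * real m) * w))"
        using R \<open>M\<^sub>1 > 0\<close> real by (simp add: ennreal_mult'[symmetric])
      also have "3 / 2 * R * (M\<^sub>1 * exp (- c * real m) * w) = Y * exp (- c * real m) * \<epsilon>"
        using \<open>\<epsilon> > 0\<close> by (simp add: Y_def)
      finally show ?thesis
        using contraction[of m] Y0 \<open>\<epsilon> > 0\<close> by (simp add: ennreal_le_iff)
    qed
    show ?thesis
    proof (cases "Y = 0")
      case True
      \<comment> \<open>The logarithm is \<open>- \<infinity>\<close> here and the claimed bound is
        1; a single smoothing step already brings the total variation to zero.\<close>
      then have "t_mix ?K \<mu>' \<epsilon> \<nu> \<le> ereal (real (Suc 0))"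
        using TV_le[of 0] \<open>\<epsilon> > 0\<close> by (intro t_mix_le) simp
      then show ?thesis by (simp add: le_max_iff_disj one_ereal_def)
    next
      case False
      then have Ypos: "Y > 0" using Y0 by simp
      \<comment> \<open>The least natural number with \<open>Y * exp (- c * real m) \<le> 1\<close>.
        Rounding up costs less than one step and smoothing costs one more, which together account
        for the summand 2.\<close>
      define m where "m = nat \<lceil>max 0 (ln Y / c)\<rceil>"
      have "ln Y / c \<le> real m" unfolding m_def by linarith
      then have "ln Y \<le> c * real m" using \<open>c > 0\<close> by (simp add: pos_divide_le_eq mult.commute)
      then have "Y \<le> exp (c * real m)" using Ypos by (metis exp_le_cancel_iff exp_ln)
      then have "Y * exp (- c * real m) \<le> 1" by (simp add: exp_minus field_simps)
      then have "Y * exp (- c * real m) * \<epsilon> \<le> \<epsilon>" using \<open>\<epsilon> > 0\<close> by simp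
      then have "t_mix ?K \<mu>' \<epsilon> \<nu> \<le> ereal (real (Suc m))"
        using TV_le[of m] by (intro t_mix_le) linarith
      also have "real (Suc m) \<le> max 1 (2 + ln Y / c)"
        unfolding m_def by (cases "ln Y / c \<le> 0") (simp_all add: max_def, linarith)
      also have "ereal (max 1 (2 + ln Y / c)) = max 1 (2 + ereal (1 / c) * ln_ennreal (ennreal Y))"
        using Ypos by (simp add: ln_ennreal_def max_def one_ereal_def numeral_eq_ereal)
      finally show ?thesis unfolding R_def[symmetric] Y by simp
    qed
  qed
qed

end
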